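(* Let $0<\alpha<1$, $0\le\beta\le 1$, $\gamma=\alpha+\beta(1-\alpha)$, $a,x_0\in\mathbb{R}$, $h>0$, $b>0$. Let $E=\{y\in\mathbb{R}:|y-x_0|\le b\}$ and let $f$ be a real-valued function defined on $G=\{(t,x): t\in(a,a+h],\ (t-a)^{1-\gamma}x\in E\}$, so that $(t,y)\mapsto f(t,(t-a)^{\gamma-1}y)$ is defined on $(a,a+h]\times E$. Let $k>\beta(1-\alpha)-1$ and $M\ge 0$ be real numbers, and put $$l=\min\left\{h,\left(\frac{b}{M}\,\frac{\Gamma(\alpha)}{\mathbb{B}(\alpha,k+1)}\right)^{\frac{1}{\mu+k}}\right\},\qquad \mu=1-\beta(1-\alpha)$$ (with $l=h$ if $M=0$). Assume: (i) for every $t\in(a,a+h]$ the map $y\mapsto f(t,(t-a)^{\gamma-1}y)$ is continuous on $E$, and for every $y\in E$ the map $t\mapsto f(t,(t-a)^{\gamma-1}y)$ is measurable on $(a,a+h]$; (ii) $|f(t,(t-a)^{\gamma-1}y)|\le M(t-a)^k$ for all $t\in(a,a+h]$ and $y\in E$; (iii) there is $A>0$ such that $|f(t,(t-a)^{\gamma-1}y_1)-f(t,(t-a)^{\gamma-1}y_2)|\le A(t-a)^k|y_1-y_2|$ for all $t\in(a,a+l]$ and $y_1,y_2\in E$. Then the initial value problem $$D_{a^+}^{\alpha,\beta}x(t)=f(t,x(t)),\quad t>a,\qquad \lim_{t\to a^+}(t-a)^{1-\gamma}x(t)=x_0,$$ has a unique continuous solution $\phi$ defined on $(a,a+l]$,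 and $$\phi(t)=(t-a)^{\gamma-1}\lim_{n\to\infty}(t-a)^{1-\gamma}\phi_n(t),\qquad t\in(a,a+l],$$ where $\phi_0(t)=x_0(t-a)^{\gamma-1}$ and, for $n=1,2,\dots$, $$\phi_n(t)=\phi_0(t)+\int_a^t\frac{(t-s)^{\alpha-1}}{\Gamma(\alpha)}f(s,\phi_{n-1}(s))\,ds,\qquad t\in(a,a+l].$$
   Context: $\Gamma$ is Euler's gamma function and $\mathbb{B}(x,y)=\int_0^1(1-s)^{x-1}s^{y-1}ds=\Gamma(x)\Gamma(y)/\Gamma(x+y)$ for $x,y>0$. The Riemann–Liouville fractional integral of order $\delta>0$ is $I_{a^+}^{\delta}g(t)=\frac{1}{\Gamma(\delta)}\int_a^t (t-s)^{\delta-1}g(s)\,ds$, $t>a$, and $I_{a^+}^0$ is the identity. The Hilfer fractional derivative of order $0<\alpha<1$ and type $0\le\beta\le1$ is $D_{a^+}^{\alpha,\beta}g=I_{a^+}^{\beta(1-\alpha)}\,\frac{d}{dt}\,I_{a^+}^{(1-\beta)(1-\alpha)}g$. A solution of the initial value problem on $(a,a+l]$ is a function $x$, continuous on $(a,a+l]$, with $(t,x(t))\in G$ for $t\in(a,a+l]$, that satisfies $D_{a^+}^{\alpha,\beta}x(t)=f(t,x(t))$ almost everywhere on $(a,a+l]$ and $\lim_{t\to a^+}(t-a)^{1-\gamma}x(t)=x_0$.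
   Formalization: The derivative d/dt in the Hilfer derivative is taken in the weak sense, with the outer fractional integral extended by duality; with a classical derivative, uniqueness fails (Cantor functions, β=0) or existence fails (Weierstrass-type f, β=1). *)

theory Defs
  imports "HOL-Analysis.Analysis"
begin

text \<open>
  Left-sided Riemann--Liouville integral of order \<open>\<delta> \<ge> 0\<close> based at \<open>a\<close>. The Lebesgue measure is
  the complete one, as the right-hand sides considered are only Lebesgue measurable in time.
\<close>

definition rl_integral :: "real \<Rightarrow> real \<Rightarrow> (real \<Rightarrow> real) \<Rightarrow> real \<Rightarrow> real" where
  "rl_integral a \<delta> g t =
     (if \<delta> = 0 then g t
      else 1 / Gamma \<delta> * (LINT s:{a<..<t}|lebesgue. (t - s) powr (\<delta> - 1) * g s))"

definition rl_integral_right :: "real \<Rightarrow> real \<Rightarrow> (real \<Rightarrow> real) \<Rightarrow> real \<Rightarrow> real" where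
  "rl_integral_right b \<delta> \<psi> t =
     (if \<delta> = 0 then \<psi> t
      else 1 / Gamma \<delta> * (LINT s:{t<..<b}|lebesgue. (s - t) powr (\<delta> - 1) * \<psi> s))"

text \<open>
  The Hilfer derivative of order \<open>\<alpha>\<close> and type \<open>\<beta>\<close> is the composition
  \<open>rl_integral a (\<beta> * (1 - \<alpha>)) \<circ> d/dt \<circ> rl_integral a ((1 - \<beta>) * (1 - \<alpha>))\<close>. Here \<open>d/dt\<close> is
  the weak derivative: for \<open>v = rl_integral a ((1 - \<beta>) * (1 - \<alpha>)) g\<close>, \<open>dv/dt\<close> is a generalised
  function on \<open>(a,b)\<close>, to which the outer integral is extended by duality. The classical reading
  (a pointwise derivative almost everywhere) does not go with equations that hold almost everywhere:
  Cantor-type functions destroy uniqueness, and if \<open>\<beta> > 0\<close>, then \<open>v\<close> need not be differentiable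
  anywhere for the solution with an irregular right-hand side. Where \<open>v\<close> is absolutely continuous,
  the weak Hilfer derivative is the classical one: see \<open>has_hilfer_deriv_classical\<close> below.

  Generalised functions are functionals on the \<open>C\<^sup>1\<close> functions that vanish near \<open>b\<close>. Test functions
  are not required to vanish near \<open>a\<close>, because \<open>rl_integral_right b \<delta>\<close> does not preserve that; hence
  the boundary term in \<open>gen_deriv\<close>, which is the one of integration by parts over \<open>(a,b)\<close>. It makes
  the derivative of a constant zero (there is no Dirac mass at \<open>a\<close>).
\<close>

definition test_function :: "real \<Rightarrow> (real \<Rightarrow> real) \<Rightarrow> bool" where
  "test_function b \<psi> \<longleftrightarrow> \<psi> C1_differentiable_on UNIV \<and> (\<exists>r<b. \<forall>t\<ge>r. \<psi> t = 0)"

definition gen_deriv :: "real \<Rightarrow> real \<Rightarrow> (real \<Rightarrow> real) \<Rightarrow> (real \<Rightarrow> real) \<Rightarrow> real" where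
  "gen_deriv a b v \<psi> =
     - Lim (at_right a) v * \<psi> a - (LINT t:{a<..<b}|lebesgue. v t * deriv \<psi> t)"

definition gen_rl_integral ::
    "real \<Rightarrow> real \<Rightarrow> ((real \<Rightarrow> real) \<Rightarrow> real) \<Rightarrow> (real \<Rightarrow> real) \<Rightarrow> real" where
  "gen_rl_integral b \<delta> F \<psi> = F (rl_integral_right b \<delta> \<psi>)"

definition hilfer_deriv ::
    "real \<Rightarrow> real \<Rightarrow> real \<Rightarrow> real \<Rightarrow> (real \<Rightarrow> real) \<Rightarrow> (real \<Rightarrow> real) \<Rightarrow> real" where
  "hilfer_deriv a b \<alpha> \<beta> g =
     gen_rl_integral b (\<beta> * (1 - \<alpha>)) (gen_deriv a b (rl_integral a ((1 - \<beta>) * (1 - \<alpha>)) g))"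

text \<open>
  \<open>has_hilfer_deriv a b \<alpha> \<beta> g u\<close>: the Hilfer derivative of \<open>g\<close> on \<open>(a,b)\<close> is the function \<open>u\<close>,
  which is thereby determined up to a null set.
\<close>

definition has_hilfer_deriv ::
    "real \<Rightarrow> real \<Rightarrow> real \<Rightarrow> real \<Rightarrow> (real \<Rightarrow> real) \<Rightarrow> (real \<Rightarrow> real) \<Rightarrow> bool" where
  "has_hilfer_deriv a b \<alpha> \<beta> g u \<longleftrightarrow>
     set_integrable lebesgue {a<..<b} g \<and>
     (\<exists>c. (rl_integral a ((1 - \<beta>) * (1 - \<alpha>)) g \<longlongrightarrow> c) (at_right a)) \<and>
     set_integrable lebesgue {a<..<b} u \<and>
     (\<forall>\<psi>. test_function b \<psi> \<longrightarrow>
        hilfer_deriv a b \<alpha> \<beta> g \<psi> = (LINT t:{a<..<b}|lebesgue. u t * \<psi> t))"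

definition hilfer_ivp_solution ::
    "(real \<times> real) set \<Rightarrow> (real \<Rightarrow> real \<Rightarrow> real) \<Rightarrow> real \<Rightarrow> real \<Rightarrow> real \<Rightarrow> real \<Rightarrow> real \<Rightarrow>
     (real \<Rightarrow> real) \<Rightarrow> bool" where
  "hilfer_ivp_solution G f \<alpha> \<beta> a x0 l x \<longleftrightarrow>
     continuous_on {a<..a + l} x \<and>
     (\<forall>t\<in>{a<..a + l}. (t, x t) \<in> G) \<and>
     (\<exists>u. has_hilfer_deriv a (a + l) \<alpha> \<beta> x u \<and>
          (AE t in lebesgue. t \<in> {a<..a + l} \<longrightarrow> u t = f t (x t))) \<and>
     ((\<lambda>t. (t - a) powr (1 - (\<alpha> + \<beta> * (1 - \<alpha>))) * x t) \<longlongrightarrow> x0) (at_right a)"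

primrec hilfer_picard ::
    "(real \<Rightarrow> real \<Rightarrow> real) \<Rightarrow> real \<Rightarrow> real \<Rightarrow> real \<Rightarrow> real \<Rightarrow> nat \<Rightarrow> real \<Rightarrow> real" where
  "hilfer_picard f \<alpha> \<gamma> a x0 0 = (\<lambda>t. x0 * (t - a) powr (\<gamma> - 1))"
| "hilfer_picard f \<alpha> \<gamma> a x0 (Suc n) = (\<lambda>t. x0 * (t - a) powr (\<gamma> - 1) +
     (LINT s:{a<..<t}|lebesgue.
        (t - s) powr (\<alpha> - 1) / Gamma \<alpha> * f s (hilfer_picard f \<alpha> \<gamma> a x0 n s)))"

lemma sigma_finite_lebesgue: "sigma_finite_measure (lebesgue :: real measure)"
proof
  show "\<exists>A::real set set. countable A \<and> A \<subseteq> sets lebesgue \<and> \<Union> A = space lebesgue \<and> (\<forall>a\<in>A. emeasure lebesgue a \<noteq> \<infinity>)"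
    by (rule exI[of _ "range (\<lambda>n::nat. {-real n..real n})"])
       (auto simp: emeasure_lborel_Icc_eq, meson abs_le_iff minus_le_iff real_arch_simple)
qed

interpretation lebesgue_pair: pair_sigma_finite "lebesgue :: real measure" "lebesgue :: real measure"
  by (simp add: pair_sigma_finite_def sigma_finite_lebesgue)

lemma set_integrable_open_real:
  fixes f :: "real \<Rightarrow> real"
  assumes f: "set_integrable lebesgue {a..b} f"
  shows "set_integrable lebesgue {a<..<b} f"
    and "(LINT x:{a<..<b}|lebesgue. f x) = integral {a..b} f"
proof -
  show *: "set_integrable lebesgue {a<..<b} f"
    by (rule set_integrable_subset[OF f]) auto
  show "(LINT x:{a<..<b}|lebesgue. f x) = integral {a..b} f"
    using set_lebesgue_integral_eq_integral(2)[OF *] by (simp add: integral_open_interval_real)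
qed

lemma kernel_right:
  fixes \<delta> t b :: real
  assumes "\<delta> > 0" "t \<le> b"
  shows "set_integrable lebesgue {t<..<b} (\<lambda>s. (s - t) powr (\<delta> - 1))"
    and "(LINT s:{t<..<b}|lebesgue. (s - t) powr (\<delta> - 1)) = (b - t) powr \<delta> / \<delta>"
proof -
  have *: "((\<lambda>s. (s - t) powr (\<delta> - 1)) has_integral ((b - t) powr \<delta> / \<delta> - (t - t) powr \<delta> / \<delta>)) {t..b}"
  proof (rule fundamental_theorem_of_calculus_interior)
    show "continuous_on {t..b} (\<lambda>s. (s - t) powr \<delta> / \<delta>)"
      using assms by (intro continuous_intros continuous_on_powr') auto
    show "((\<lambda>s. (s - t) powr \<delta> / \<delta>) has_vector_derivative (x - t) powr (\<delta> - 1)) (at x)"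
      if "x \<in> {t<..<b}" for x
      unfolding has_real_derivative_iff_has_vector_derivative[symmetric]
      using that assms by (auto intro!: derivative_eq_intros simp: powr_diff field_simps)
  qed (use assms in auto)
  have ai: "(\<lambda>s. (s - t) powr (\<delta> - 1)) absolutely_integrable_on {t..b}"
    by (rule nonnegative_absolutely_integrable_1) (use * in \<open>auto simp: has_integral_iff\<close>)
  show "set_integrable lebesgue {t<..<b} (\<lambda>s. (s - t) powr (\<delta> - 1))"
    using ai by (simp add: set_integrable_open_real)
  show "(LINT s:{t<..<b}|lebesgue. (s - t) powr (\<delta> - 1)) = (b - t) powr \<delta> / \<delta>"
    using ai * assms by (simp add: set_integrable_open_real set_lebesgue_integral_eq_integral integral_open_interval_real has_integral_iff)
qed

lemma kernel_left:
  fixes \<delta> t b :: real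
  assumes "\<delta> > 0" "a \<le> t"
  shows "set_integrable lebesgue {a<..<t} (\<lambda>s. (t - s) powr (\<delta> - 1))"
    and "(LINT s:{a<..<t}|lebesgue. (t - s) powr (\<delta> - 1)) = (t - a) powr \<delta> / \<delta>"
proof -
  have *: "((\<lambda>s. (t - s) powr (\<delta> - 1)) has_integral (- ((t - t) powr \<delta> / \<delta>) - (- ((t - a) powr \<delta> / \<delta>)))) {a..t}"
  proof (rule fundamental_theorem_of_calculus_interior)
    show "continuous_on {a..t} (\<lambda>s. - ((t - s) powr \<delta> / \<delta>))"
      using assms by (intro continuous_intros continuous_on_powr') auto
    show "((\<lambda>s. - ((t - s) powr \<delta> / \<delta>)) has_vector_derivative (t - x) powr (\<delta> - 1)) (at x)"
      if "x \<in> {a<..<t}" for x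
      unfolding has_real_derivative_iff_has_vector_derivative[symmetric]
      using that assms by (auto intro!: derivative_eq_intros simp: powr_diff field_simps)
  qed (use assms in auto)
  have ai: "(\<lambda>s. (t - s) powr (\<delta> - 1)) absolutely_integrable_on {a..t}"
    by (rule nonnegative_absolutely_integrable_1) (use * in \<open>auto simp: has_integral_iff\<close>)
  show "set_integrable lebesgue {a<..<t} (\<lambda>s. (t - s) powr (\<delta> - 1))"
    using ai by (simp add: set_integrable_open_real)
  show "(LINT s:{a<..<t}|lebesgue. (t - s) powr (\<delta> - 1)) = (t - a) powr \<delta> / \<delta>"
    using ai * assms by (simp add: set_integrable_open_real set_lebesgue_integral_eq_integral integral_open_interval_real has_integral_iff)
qed

lemma kernel_Fubini:
  fixes w \<psi> :: "real \<Rightarrow> real"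
  assumes \<delta>: "\<delta> > 0" and w: "set_integrable lebesgue {a<..<b} w"
    and \<psi>[measurable]: "\<psi> \<in> borel_measurable borel"
    and B: "\<And>t. t \<in> {a<..<b} \<Longrightarrow> \<bar>\<psi> t\<bar> \<le> B"
  shows "set_integrable lebesgue {a<..<b}
           (\<lambda>t. (LINT s:{a<..<t}|lebesgue. (t - s) powr (\<delta> - 1) * w s) * \<psi> t)"
    and "(LINT t:{a<..<b}|lebesgue. (LINT s:{a<..<t}|lebesgue. (t - s) powr (\<delta> - 1) * w s) * \<psi> t) =
         (LINT s:{a<..<b}|lebesgue. w s * (LINT t:{s<..<b}|lebesgue. (t - s) powr (\<delta> - 1) * \<psi> t))"
proof -
  define w' where "w' = (\<lambda>s. indicat_real {a<..<b} s * w s)"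
  have w'i: "integrable lebesgue w'" using w by (simp add: w'_def set_integrable_def)
  then have w'm[measurable]: "w' \<in> borel_measurable lebesgue" by auto
  have [measurable]: "(\<lambda>x. x) \<in> lebesgue \<rightarrow>\<^sub>M (borel :: real measure)" 
    by (simp add: measurable_completion)
  define H where "H = (\<lambda>(s, t). indicat_real {a<..<b} t * indicat_real {(s, t). s < t} (s, t) * (t - s) powr (\<delta> - 1) * w' s * \<psi> t)"
  have f1[measurable]: "fst \<in> lebesgue \<Otimes>\<^sub>M lebesgue \<rightarrow>\<^sub>M (borel :: real measure)" 
    using measurable_compose[OF measurable_fst \<open>(\<lambda>x. x) \<in> lebesgue \<rightarrow>\<^sub>M (borel :: real measure)\<close>] by simp
  have f2[measurable]: "snd \<in> lebesgue \<Otimes>\<^sub>M lebesgue \<rightarrow>\<^sub>M (borel :: real measure)"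
    using measurable_compose[OF measurable_snd \<open>(\<lambda>x. x) \<in> lebesgue \<rightarrow>\<^sub>M (borel :: real measure)\<close>] by simp
  have [measurable]: "(\<lambda>x. w' (fst x)) \<in> borel_measurable (lebesgue \<Otimes>\<^sub>M lebesgue)"
    by (rule measurable_compose[OF measurable_fst w'm])
  have H_alt: "H = (\<lambda>x. (if a < snd x \<and> snd x < b \<and> fst x < snd x then 1 else 0) * (snd x - fst x) powr (\<delta> - 1) * w' (fst x) * \<psi> (snd x))"
    by (auto simp: H_def fun_eq_iff indicator_def)
  have Hm: "H \<in> borel_measurable (lebesgue \<Otimes>\<^sub>M lebesgue)"
    unfolding H_alt by measurable
  have Hs: "H (s, t) = w' s * (indicator {s<..<b} t * ((t - s) powr (\<delta> - 1) * \<psi> t))" for s t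
    by (auto simp: H_def w'_def indicator_def)
  have Ht: "H (s, t) = indicator {a<..<b} t * \<psi> t * (indicator {a<..<t} s * ((t - s) powr (\<delta> - 1) * w s))" for s t
    by (auto simp: H_def w'_def indicator_def)
  have inner: "set_integrable lebesgue {s<..<b} (\<lambda>t. (t - s) powr (\<delta> - 1) * \<psi> t)"
    and inner_le: "(LINT t:{s<..<b}|lebesgue. \<bar>(t - s) powr (\<delta> - 1) * \<psi> t\<bar>) \<le> B * ((b - a) powr \<delta> / \<delta>)"
    if "s \<in> {a<..<b}" for s
  proof -
    have k: "set_integrable lebesgue {s<..<b} (\<lambda>t. B * (t - s) powr (\<delta> - 1))"
      using kernel_right(1)[of \<delta> s b] \<delta> that by simp
    show i: "set_integrable lebesgue {s<..<b} (\<lambda>t. (t - s) powr (\<delta> - 1) * \<psi> t)"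
    proof (rule set_integrable_bound[OF k])
      show "set_borel_measurable lebesgue {s<..<b} (\<lambda>t. (t - s) powr (\<delta> - 1) * \<psi> t)"
        unfolding set_borel_measurable_def by measurable
      show "AE x in lebesgue. x \<in> {s<..<b} \<longrightarrow> norm ((x - s) powr (\<delta> - 1) * \<psi> x) \<le> norm (B * (x - s) powr (\<delta> - 1))"
      proof (intro AE_I2 impI)
        fix x assume "x \<in> {s<..<b}"
        then have "\<bar>\<psi> x\<bar> \<le> B" using that by (intro B) auto
        then have "\<bar>(x - s) powr (\<delta> - 1)\<bar> * \<bar>\<psi> x\<bar> \<le> \<bar>(x - s) powr (\<delta> - 1)\<bar> * \<bar>B\<bar>"
          by (intro mult_left_mono) auto
        then show "norm ((x - s) powr (\<delta> - 1) * \<psi> x) \<le> norm (B * (x - s) powr (\<delta> - 1))"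
          unfolding real_norm_def abs_mult mult.commute[of "\<bar>B\<bar>"] .
      qed
    qed
    have "(LINT t:{s<..<b}|lebesgue. \<bar>(t - s) powr (\<delta> - 1) * \<psi> t\<bar>) \<le> (LINT t:{s<..<b}|lebesgue. B * (t - s) powr (\<delta> - 1))"
    proof (intro set_integral_mono k set_integrable_abs i)
      fix x assume "x \<in> {s<..<b}"
      then have "\<bar>\<psi> x\<bar> \<le> B" using that by (intro B) auto
      then have "(x - s) powr (\<delta> - 1) * \<bar>\<psi> x\<bar> \<le> (x - s) powr (\<delta> - 1) * B"
        by (intro mult_left_mono) auto
      then show "\<bar>(x - s) powr (\<delta> - 1) * \<psi> x\<bar> \<le> B * (x - s) powr (\<delta> - 1)"
        by (simp add: abs_mult mult.commute)
    qed
    also have "\<dots> = B * ((b - s) powr \<delta> / \<delta>)" using kernel_right(2)[of \<delta> s b] \<delta> that by simp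
    also have "\<dots> \<le> B * ((b - a) powr \<delta> / \<delta>)"
    proof -
      have "B \<ge> 0" using B[OF that] by linarith
      moreover have "(b - s) powr \<delta> \<le> (b - a) powr \<delta>" using that \<delta> by (intro powr_mono2) auto
      ultimately show ?thesis using \<delta> by (intro mult_left_mono divide_right_mono) auto
    qed
    finally show "(LINT t:{s<..<b}|lebesgue. \<bar>(t - s) powr (\<delta> - 1) * \<psi> t\<bar>) \<le> B * ((b - a) powr \<delta> / \<delta>)" .
  qed
  have sec: "integrable lebesgue (\<lambda>t. H (s, t))" for s
  proof (cases "s \<in> {a<..<b}")
    case True
    then show ?thesis using inner[OF True] unfolding Hs set_integrable_def by (intro integrable_mult_right) simp
  qed (simp add: Hs w'_def)
  have Hi: "integrable (lebesgue \<Otimes>\<^sub>M lebesgue) H"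
  proof (rule lebesgue_pair.Fubini_integrable[OF Hm])
    show "integrable lebesgue (\<lambda>s. LINT t|lebesgue. norm (H (s, t)))"
    proof (rule Bochner_Integration.integrable_bound[of _ "\<lambda>s. (B * ((b - a) powr \<delta> / \<delta>)) * w' s"])
      show "integrable lebesgue (\<lambda>s. (B * ((b - a) powr \<delta> / \<delta>)) * w' s)" using w'i by simp
      have nm: "(\<lambda>x. norm (H x)) \<in> borel_measurable (lebesgue \<Otimes>\<^sub>M lebesgue)" using Hm by simp
      show "(\<lambda>s. LINT t|lebesgue. norm (H (s, t))) \<in> borel_measurable lebesgue"
        by (rule sigma_finite_measure.borel_measurable_lebesgue_integral[OF sigma_finite_lebesgue]) (use nm in simp)
      show "AE s in lebesgue. norm (LINT t|lebesgue. norm (H (s, t))) \<le> norm (B * ((b - a) powr \<delta> / \<delta>) * w' s)"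
      proof (rule AE_I2)
        fix s
        show "norm (LINT t|lebesgue. norm (H (s, t))) \<le> norm (B * ((b - a) powr \<delta> / \<delta>) * w' s)"
        proof (cases "s \<in> {a<..<b}")
          case True
          have "(LINT t|lebesgue. norm (H (s, t))) = \<bar>w' s\<bar> * (LINT t:{s<..<b}|lebesgue. \<bar>(t - s) powr (\<delta> - 1) * \<psi> t\<bar>)"
            unfolding set_lebesgue_integral_def Hs by (subst integral_mult_right_zero[symmetric], rule Bochner_Integration.integral_cong) (auto simp: abs_mult indicator_def)
          also have "\<dots> \<le> \<bar>w' s\<bar> * (B * ((b - a) powr \<delta> / \<delta>))" using inner_le[OF True] by (intro mult_left_mono) auto
          finally have "(LINT t|lebesgue. norm (H (s, t))) \<le> \<bar>w' s\<bar> * (B * ((b - a) powr \<delta> / \<delta>))" .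
          moreover have "(LINT t|lebesgue. norm (H (s, t))) \<ge> 0" by simp
          moreover have "\<bar>w' s\<bar> * (B * ((b - a) powr \<delta> / \<delta>)) \<le> \<bar>w' s\<bar> * \<bar>B * ((b - a) powr \<delta> / \<delta>)\<bar>"
            by (intro mult_left_mono abs_ge_self) auto
          ultimately show ?thesis by (simp add: abs_mult mult.commute)
        qed (simp add: Hs w'_def)
      qed
    qed
    show "AE x in lebesgue. integrable lebesgue (\<lambda>y. H (x, y))" using sec by simp
  qed
  have Hi': "integrable (lebesgue \<Otimes>\<^sub>M lebesgue) (\<lambda>(s, t). H (s, t))" using Hi by (simp add: case_prod_eta)
  have e1: "(LINT s|lebesgue. H (s, t)) = indicator {a<..<b} t * ((LINT s:{a<..<t}|lebesgue. (t - s) powr (\<delta> - 1) * w s) * \<psi> t)" for t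
    unfolding Ht set_lebesgue_integral_def by simp
  have e2: "(LINT t|lebesgue. H (s, t)) = indicator {a<..<b} s * (w s * (LINT t:{s<..<b}|lebesgue. (t - s) powr (\<delta> - 1) * \<psi> t))" for s
    unfolding Hs set_lebesgue_integral_def by (simp add: w'_def)
  show "set_integrable lebesgue {a<..<b}
           (\<lambda>t. (LINT s:{a<..<t}|lebesgue. (t - s) powr (\<delta> - 1) * w s) * \<psi> t)"
    using lebesgue_pair.integrable_snd[OF Hi'] unfolding e1 set_integrable_def by simp
  show "(LINT t:{a<..<b}|lebesgue. (LINT s:{a<..<t}|lebesgue. (t - s) powr (\<delta> - 1) * w s) * \<psi> t) =
         (LINT s:{a<..<b}|lebesgue. w s * (LINT t:{s<..<b}|lebesgue. (t - s) powr (\<delta> - 1) * \<psi> t))"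
    using lebesgue_pair.Fubini_integral[OF Hi'] unfolding e1 e2 by (simp add: set_lebesgue_integral_def)
qed


lemma continuous_rl_integral_right:
  fixes p :: "real \<Rightarrow> real"
  assumes \<delta>: "\<delta> > 0" and p: "continuous_on UNIV p" and r: "r < b" "\<And>t. t \<ge> r \<Longrightarrow> p t = 0"
  shows "continuous_on UNIV (rl_integral_right b \<delta> p)"
proof -
  have pm[measurable]: "p \<in> borel_measurable borel"
    using p by (simp add: borel_measurable_continuous_onI)
  have [measurable]: "(\<lambda>x. x) \<in> lebesgue \<rightarrow>\<^sub>M (borel :: real measure)"
    by (simp add: measurable_completion)
  have "isCont (rl_integral_right b \<delta> p) t0" for t0
  proof -
    define lo where "lo = min (t0 - 1) (b - 1)"
    define H where "H = (\<lambda>t. LINT x|lebesgue. indicat_real {0<..<b - lo} x * (x powr (\<delta> - 1) * p (t + x)))"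
    have eq: "rl_integral_right b \<delta> p t = 1 / Gamma \<delta> * H t" if "t > lo" for t
    proof -
      have "(LINT s:{t<..<b}|lebesgue. (s - t) powr (\<delta> - 1) * p s)
          = (LINT x|lebesgue. indicat_real {t<..<b} (t + 1 * x) *\<^sub>R ((t + 1 * x - t) powr (\<delta> - 1) * p (t + 1 * x)))"
        unfolding set_lebesgue_integral_def by (subst lebesgue_integral_real_affine[of 1 _ t]) simp_all
      also have "\<dots> = H t"
        unfolding H_def
      proof (rule Bochner_Integration.integral_cong[OF refl])
        fix x
        show "indicat_real {t<..<b} (t + 1 * x) *\<^sub>R ((t + 1 * x - t) powr (\<delta> - 1) * p (t + 1 * x))
            = indicat_real {0<..<b - lo} x * (x powr (\<delta> - 1) * p (t + x))"
          using that r(2)[of "t + x"] r(1) by (auto simp: indicator_def)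
      qed
      finally show ?thesis using \<delta> by (simp add: rl_integral_right_def)
    qed
    have "isCont H t0"
    proof (rule continuous_at_sequentiallyI)
      fix u :: "nat \<Rightarrow> real" assume u: "u \<longlonglongrightarrow> t0"
      then have "Bseq u" using convergentI convergent_imp_Bseq by blast
      then obtain K where K: "\<And>n. \<bar>u n\<bar> \<le> K" by (auto simp: Bseq_def)
      have "compact (p ` {-K..K + (b - lo)})"
        by (intro compact_continuous_image continuous_on_subset[OF p]) auto
      then have "bounded (p ` {-K..K + (b - lo)})" by (rule compact_imp_bounded)
      then obtain C where C: "\<And>x. x \<in> {-K..K + (b - lo)} \<Longrightarrow> \<bar>p x\<bar> \<le> C"
        unfolding bounded_real by (metis imageI)
      show "(\<lambda>n. H (u n)) \<longlonglongrightarrow> H t0"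
        unfolding H_def
      proof (rule integral_dominated_convergence[where w = "\<lambda>x. indicat_real {0<..<b - lo} x * (x powr (\<delta> - 1) * C)"])
        show "integrable lebesgue (\<lambda>x. indicat_real {0<..<b - lo} x * (x powr (\<delta> - 1) * C))"
          using kernel_right(1)[of \<delta> 0 "b - lo"] \<delta>
          by (auto simp: set_integrable_def lo_def mult.assoc[symmetric])
        show "AE x in lebesgue. (\<lambda>n. indicat_real {0<..<b - lo} x * (x powr (\<delta> - 1) * p (u n + x)))
            \<longlonglongrightarrow> indicat_real {0<..<b - lo} x * (x powr (\<delta> - 1) * p (t0 + x))"
          by (intro AE_I2 tendsto_intros continuous_on_tendsto_compose[OF p] u) auto
        show "AE x in lebesgue. norm (indicat_real {0<..<b - lo} x * (x powr (\<delta> - 1) * p (u n + x)))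
            \<le> indicat_real {0<..<b - lo} x * (x powr (\<delta> - 1) * C)" for n
        proof (rule AE_I2)
          fix x
          have "\<bar>p (u n + x)\<bar> \<le> C" if "x \<in> {0<..<b - lo}"
            using that K[of n] by (intro C) (auto simp: abs_le_iff)
          then show "norm (indicat_real {0<..<b - lo} x * (x powr (\<delta> - 1) * p (u n + x)))
            \<le> indicat_real {0<..<b - lo} x * (x powr (\<delta> - 1) * C)"
            by (auto simp: indicator_def abs_mult intro!: mult_left_mono)
        qed
      qed measurable
    qed
    then have "isCont (\<lambda>t. 1 / Gamma \<delta> * H t) t0" by (intro continuous_intros)
    moreover have "\<forall>\<^sub>F t in nhds t0. rl_integral_right b \<delta> p t = 1 / Gamma \<delta> * H t"
    proof (rule eventually_mono)
      show "\<forall>\<^sub>F t in nhds t0. t \<in> {lo<..}"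
        by (rule eventually_nhds_in_open) (auto simp: lo_def)
    qed (simp add: eq)
    ultimately show ?thesis by (simp only: isCont_cong)
  qed
  then show ?thesis by (simp add: continuous_on_eq_continuous_at)
qed

lemma test_functionE:
  assumes "test_function b \<psi>"
  obtains D r where "\<And>t. (\<psi> has_real_derivative D t) (at t)" "continuous_on UNIV D"
    "r < b" "\<And>t. t \<ge> r \<Longrightarrow> \<psi> t = 0" "\<And>t. t \<ge> r \<Longrightarrow> D t = 0"
proof -
  obtain D r where D: "\<And>t. (\<psi> has_real_derivative D t) (at t)" "continuous_on UNIV D"
    and r: "r < b" "\<And>t. t \<ge> r \<Longrightarrow> \<psi> t = 0"
    using assms by (auto simp: test_function_def C1_differentiable_on_def has_real_derivative_iff_has_vector_derivative)
  have "D t = 0" if "t > r" for t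
  proof -
    have "\<forall>\<^sub>F x in nhds t. \<psi> x = 0"
      using eventually_nhds_in_open[of "{r<..}" t] that r by (auto elim!: eventually_mono)
    then have "(\<psi> has_real_derivative 0) (at t)"
      by (subst DERIV_cong_ev[OF refl _ refl, of _ "\<lambda>_. 0"]) auto
    then show ?thesis using D(1) DERIV_unique by blast
  qed
  then show ?thesis using r D by (intro that[of D "(r + b) / 2"]) (auto simp: field_simps)
qed

lemma C1_eq_integral:
  assumes "\<And>t. (\<psi> has_real_derivative D t) (at t)" "continuous_on UNIV D" "\<psi> b = 0" "s \<le> b"
  shows "set_integrable lebesgue {s<..<b} D" "(LINT u:{s<..<b}|lebesgue. D u) = - \<psi> s"
proof -
  have i: "D absolutely_integrable_on {s..b}"
    by (rule absolutely_integrable_continuous_real) (use assms(2) continuous_on_subset in blast)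
  then show "set_integrable lebesgue {s<..<b} D" by (rule set_integrable_open_real)
  have "(D has_integral (\<psi> b - \<psi> s)) {s..b}"
    using assms by (intro fundamental_theorem_of_calculus)
      (auto simp: has_real_derivative_iff_has_vector_derivative intro: has_vector_derivative_at_within)
  then show "(LINT u:{s<..<b}|lebesgue. D u) = - \<psi> s"
    using set_integrable_open_real(2)[OF i] assms by (simp add: has_integral_iff)
qed

lemma bounded_on_Ioo:
  fixes p :: "real \<Rightarrow> real"
  assumes "continuous_on UNIV p"
  obtains B where "\<And>t. t \<in> {s<..<b} \<Longrightarrow> \<bar>p t\<bar> \<le> B"
proof -
  have "compact (p ` {s..b})"
    by (intro compact_continuous_image continuous_on_subset[OF assms]) auto
  then have "bounded (p ` {s..b})" by (rule compact_imp_bounded)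
  then obtain B where "\<And>x. x \<in> {s..b} \<Longrightarrow> \<bar>p x\<bar> \<le> B"
    unfolding bounded_real by (metis imageI)
  then show ?thesis by (intro that[of B]) auto
qed

lemma rl_integral_right_C1:
  assumes \<delta>: "\<delta> \<ge> 0"
    and D: "\<And>t. (\<psi> has_real_derivative D t) (at t)" "continuous_on UNIV D"
    and r: "r < b" "\<And>t. t \<ge> r \<Longrightarrow> \<psi> t = 0" "\<And>t. t \<ge> r \<Longrightarrow> D t = 0"
  shows "continuous_on UNIV (rl_integral_right b \<delta> D)"
    and "t < b \<Longrightarrow> (LINT s:{t<..<b}|lebesgue. rl_integral_right b \<delta> D s) = - rl_integral_right b \<delta> \<psi> t"
    and "t < b \<Longrightarrow> (rl_integral_right b \<delta> \<psi> has_real_derivative rl_integral_right b \<delta> D t) (at t)"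
proof -
  show cont: "continuous_on UNIV (rl_integral_right b \<delta> D)"
  proof (cases "\<delta> = 0")
    case False
    then show ?thesis using continuous_rl_integral_right[OF _ D(2) r(1) r(3)] \<delta> by auto
  qed (use D in \<open>simp add: rl_integral_right_def[abs_def]\<close>)
  have Dm: "D \<in> borel_measurable borel" using D(2) by (simp add: borel_measurable_continuous_onI)
  have eq: "(LINT s:{t<..<b}|lebesgue. rl_integral_right b \<delta> D s) = - rl_integral_right b \<delta> \<psi> t" if "t < b" for t
  proof (cases "\<delta> = 0")
    case True
    then show ?thesis using C1_eq_integral(2)[OF D, of b t] r that by (simp add: rl_integral_right_def)
  next
    case False
    with \<delta> have \<delta>: "\<delta> > 0" by simp
    obtain B where B: "\<And>s. s \<in> {t<..<b} \<Longrightarrow> \<bar>D s\<bar> \<le> B" using bounded_on_Ioo[OF D(2)] by blast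
    have one: "set_integrable lebesgue {t<..<b} (\<lambda>_. 1::real)"
      by (intro set_integrable_open_real absolutely_integrable_continuous_real) simp
    have "(LINT s:{t<..<b}|lebesgue. (s - t) powr (\<delta> - 1) * \<psi> s)
        = (LINT s:{t<..<b}|lebesgue. (s - t) powr (\<delta> - 1) * - (LINT u:{s<..<b}|lebesgue. (u - s) powr (1 - 1) * D u))"
    proof (rule set_lebesgue_integral_cong)
      show "\<forall>x. x \<in> {t<..<b} \<longrightarrow> (x - t) powr (\<delta> - 1) * \<psi> x = (x - t) powr (\<delta> - 1) * - (LINT u:{x<..<b}|lebesgue. (u - x) powr (1 - 1) * D u)"
      proof (intro allI impI)
        fix x assume x: "x \<in> {t<..<b}"
        have "(LINT u:{x<..<b}|lebesgue. (u - x) powr (1 - 1) * D u) = (LINT u:{x<..<b}|lebesgue. D u)"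
          by (rule set_lebesgue_integral_cong) auto
        also have "\<dots> = - \<psi> x" using C1_eq_integral(2)[OF D, of b x] r x by simp
        finally show "(x - t) powr (\<delta> - 1) * \<psi> x = (x - t) powr (\<delta> - 1) * - (LINT u:{x<..<b}|lebesgue. (u - x) powr (1 - 1) * D u)"
          by simp
      qed
    qed simp
    also have "\<dots> = - (LINT u:{t<..<b}|lebesgue. (LINT s:{t<..<u}|lebesgue. (u - s) powr (1 - 1) * (s - t) powr (\<delta> - 1)) * D u)"
      using kernel_Fubini(2)[OF zero_less_one kernel_right(1)[OF \<delta> less_imp_le[OF that]] Dm B]
      by (simp add: set_lebesgue_integral_def)
    also have "(LINT u:{t<..<b}|lebesgue. (LINT s:{t<..<u}|lebesgue. (u - s) powr (1 - 1) * (s - t) powr (\<delta> - 1)) * D u)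
        = (LINT u:{t<..<b}|lebesgue. (LINT s:{t<..<u}|lebesgue. (u - s) powr (\<delta> - 1) * 1) * D u)"
    proof (rule set_lebesgue_integral_cong)
      have "(LINT s:{t<..<u}|lebesgue. (u - s) powr (1 - 1) * (s - t) powr (\<delta> - 1)) = (LINT s:{t<..<u}|lebesgue. (s - t) powr (\<delta> - 1))" for u
        by (rule set_lebesgue_integral_cong) auto
      then show "\<forall>u. u \<in> {t<..<b} \<longrightarrow> (LINT s:{t<..<u}|lebesgue. (u - s) powr (1 - 1) * (s - t) powr (\<delta> - 1)) * D u
         = (LINT s:{t<..<u}|lebesgue. (u - s) powr (\<delta> - 1) * 1) * D u"
        using kernel_right(2)[OF \<delta>, of t] kernel_left(2)[OF \<delta>, of t] by simp
    qed simp
    also have "\<dots> = (LINT s:{t<..<b}|lebesgue. 1 * (LINT u:{s<..<b}|lebesgue. (u - s) powr (\<delta> - 1) * D u))"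
      by (rule kernel_Fubini(2)[OF \<delta> one Dm B])
    finally show ?thesis using False by (simp add: rl_integral_right_def)
  qed
  then show "t < b \<Longrightarrow> (LINT s:{t<..<b}|lebesgue. rl_integral_right b \<delta> D s) = - rl_integral_right b \<delta> \<psi> t" .
  assume t: "t < b"
  have ci: "continuous_on {t - 1..b} (rl_integral_right b \<delta> D)"
    using cont continuous_on_subset by blast
  have eq': "rl_integral_right b \<delta> \<psi> s = - integral {s..b} (rl_integral_right b \<delta> D)" if "s < b" for s
    using eq[OF that] set_integrable_open_real(2)[OF absolutely_integrable_continuous_real, of s b "rl_integral_right b \<delta> D"]
      continuous_on_subset[OF cont] by simp
  have "((\<lambda>s. integral {s..b} (rl_integral_right b \<delta> D)) has_real_derivative - rl_integral_right b \<delta> D t) (at t within {t - 1..b})"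
    using t by (intro integral_has_real_derivative' ci) auto
  then have "((\<lambda>s. integral {s..b} (rl_integral_right b \<delta> D)) has_real_derivative - rl_integral_right b \<delta> D t) (at t)"
    using t by (subst (asm) at_within_interior) (auto simp: interior_atLeastAtMost_real)
  then have "((\<lambda>s. - integral {s..b} (rl_integral_right b \<delta> D)) has_real_derivative rl_integral_right b \<delta> D t) (at t)"
    by (auto intro!: derivative_eq_intros)
  moreover have "\<forall>\<^sub>F s in nhds t. rl_integral_right b \<delta> \<psi> s = - integral {s..b} (rl_integral_right b \<delta> D)"
    using eventually_nhds_in_open[of "{..<b}" t] eq' t by (auto elim!: eventually_mono)
  ultimately show "(rl_integral_right b \<delta> \<psi> has_real_derivative rl_integral_right b \<delta> D t) (at t)"
    by (subst DERIV_cong_ev[OF refl _ refl]) 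
qed

lemma tendsto_integral_at_right:
  fixes w :: "real \<Rightarrow> real"
  assumes "a < b" "set_integrable lebesgue {a<..<b} w"
  shows "((\<lambda>t. LINT s:{a<..<t}|lebesgue. w s) \<longlongrightarrow> 0) (at_right a)"
proof (rule tendsto_at_right_sequentially[OF \<open>a < b\<close>])
  fix S :: "nat \<Rightarrow> real"
  assume S: "\<And>n. a < S n" "\<And>n. S n < b" "decseq S" "S \<longlonglongrightarrow> a"
  have wi: "integrable lebesgue (\<lambda>s. indicat_real {a<..<b} s * w s)"
    using assms(2) by (simp add: set_integrable_def)
  have eq: "indicat_real {a<..<S n} s * w s = indicat_real {a<..<S n} s * (indicat_real {a<..<b} s * w s)" for n s
    using S(2)[of n] by (auto simp: indicator_def)
  have "(\<lambda>n. LINT s|lebesgue. indicat_real {a<..<S n} s * w s) \<longlonglongrightarrow> (LINT s|(lebesgue :: real measure). 0)"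
  proof (rule integral_dominated_convergence[where w = "\<lambda>s. \<bar>indicat_real {a<..<b} s * w s\<bar>"])
    show "AE x in lebesgue. (\<lambda>n. indicat_real {a<..<S n} x * w x) \<longlonglongrightarrow> 0"
    proof (rule AE_I2)
      fix x
      have "\<forall>\<^sub>F n in sequentially. indicat_real {a<..<S n} x * w x = 0"
      proof (cases "x > a")
        case True
        have "\<forall>\<^sub>F n in sequentially. S n < x" using order_tendstoD(2)[OF S(4)] True .
        then show ?thesis by (rule eventually_mono) (simp add: indicator_def)
      qed (auto simp: indicator_def)
      then show "(\<lambda>n. indicat_real {a<..<S n} x * w x) \<longlonglongrightarrow> 0" by (rule tendsto_eventually)
    qed
    show "(\<lambda>s. indicat_real {a<..<S n} s * w s) \<in> borel_measurable lebesgue" for n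
      unfolding eq by (rule borel_measurable_times[OF _ borel_measurable_integrable[OF wi]])
        (simp add: borel_measurable_indicator)
    show "AE x in lebesgue. norm (indicat_real {a<..<S n} x * w x) \<le> \<bar>indicat_real {a<..<b} x * w x\<bar>" for n
      using S(2)[of n] by (intro AE_I2) (auto simp: indicator_def)
  qed (use wi in auto)
  then show "(\<lambda>n. LINT s:{a<..<S n}|lebesgue. w s) \<longlonglongrightarrow> 0" by (simp add: set_lebesgue_integral_def)
qed

text \<open>
  The hypothesis on \<open>rl_integral a ((1 - \<beta>) * (1 - \<alpha>)) g\<close> says that it is absolutely continuous
  with derivative \<open>w\<close>, so the classical Hilfer derivative of \<open>g\<close> is \<open>rl_integral a (\<beta> * (1 - \<alpha>)) w\<close>.
\<close>

lemma has_hilfer_deriv_classical: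
  assumes "\<alpha> < 1" "0 \<le> \<beta>" "a < b"
    and g: "set_integrable lebesgue {a<..<b} g"
    and w: "set_integrable lebesgue {a<..<b} w"
    and v: "\<And>t. t \<in> {a<..<b} \<Longrightarrow>
      rl_integral a ((1 - \<beta>) * (1 - \<alpha>)) g t = c + (LINT s:{a<..<t}|lebesgue. w s)"
  shows "has_hilfer_deriv a b \<alpha> \<beta> g (rl_integral a (\<beta> * (1 - \<alpha>)) w)"
proof -
  define \<delta> where "\<delta> = \<beta> * (1 - \<alpha>)"
  have \<delta>: "\<delta> \<ge> 0" using assms by (simp add: \<delta>_def)
  define V where "V = rl_integral a ((1 - \<beta>) * (1 - \<alpha>)) g"
  have Vlim: "(V \<longlongrightarrow> c) (at_right a)"
  proof -
    have "((\<lambda>t. c + (LINT s:{a<..<t}|lebesgue. w s)) \<longlongrightarrow> c + 0) (at_right a)"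
      by (intro tendsto_intros tendsto_integral_at_right[OF \<open>a < b\<close> w])
    moreover have "\<forall>\<^sub>F t in at_right a. V t = c + (LINT s:{a<..<t}|lebesgue. w s)"
      using v \<open>a < b\<close> unfolding V_def eventually_at_right_field by (meson greaterThanLessThan_iff)
    ultimately show ?thesis by (subst tendsto_cong) auto
  qed
  then have Lim: "Lim (at_right a) V = c" by (intro tendsto_Lim) auto
  have ui: "set_integrable lebesgue {a<..<b} (rl_integral a \<delta> w)"
  proof (cases "\<delta> = 0")
    case False
    then show ?thesis using kernel_Fubini(1)[OF _ w, of \<delta> "\<lambda>_. 1" 1] \<delta> by (simp add: rl_integral_def[abs_def])
  qed (use w in \<open>simp add: rl_integral_def[abs_def]\<close>)
  moreover have "hilfer_deriv a b \<alpha> \<beta> g \<psi> = (LINT t:{a<..<b}|lebesgue. rl_integral a \<delta> w t * \<psi> t)"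
    if "test_function b \<psi>" for \<psi>
  proof -
    obtain D r where D: "\<And>t. (\<psi> has_real_derivative D t) (at t)" "continuous_on UNIV D"
      and r: "r < b" "\<And>t. t \<ge> r \<Longrightarrow> \<psi> t = 0" "\<And>t. t \<ge> r \<Longrightarrow> D t = 0"
      using test_functionE[OF \<open>test_function b \<psi>\<close>] by metis
    define \<xi> where "\<xi> = rl_integral_right b \<delta> \<psi>"
    define \<rho> where "\<rho> = rl_integral_right b \<delta> D"
    note C1 = rl_integral_right_C1[OF \<delta> D r, folded \<xi>_def \<rho>_def]
    have \<rho>m: "\<rho> \<in> borel_measurable borel" using C1(1) by (simp add: borel_measurable_continuous_onI)
    have \<psi>c: "continuous_on UNIV \<psi>" using D(1) by (meson DERIV_isCont continuous_at_imp_continuous_on)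
    then have \<psi>m: "\<psi> \<in> borel_measurable borel" by (simp add: borel_measurable_continuous_onI)
    obtain B where B: "\<And>s. s \<in> {a<..<b} \<Longrightarrow> \<bar>\<rho> s\<bar> \<le> B" using bounded_on_Ioo[OF C1(1)] by blast
    obtain B' where B': "\<And>s. s \<in> {a<..<b} \<Longrightarrow> \<bar>\<psi> s\<bar> \<le> B'" using bounded_on_Ioo[OF \<psi>c] by blast
    have \<rho>i: "set_integrable lebesgue {a<..<b} \<rho>"
      using C1(1) continuous_on_subset by (intro set_integrable_open_real absolutely_integrable_continuous_real) blast
    have W: "(LINT s:{a<..<t}|lebesgue. (t - s) powr (1 - 1) * w s) = (LINT s:{a<..<t}|lebesgue. w s)" for t
      by (rule set_lebesgue_integral_cong) auto
    have "(LINT t:{a<..<b}|lebesgue. V t * deriv \<xi> t)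
        = (LINT t:{a<..<b}|lebesgue. c * \<rho> t + (LINT s:{a<..<t}|lebesgue. (t - s) powr (1 - 1) * w s) * \<rho> t)"
      using v DERIV_imp_deriv[OF C1(3)] unfolding W
      by (intro set_lebesgue_integral_cong) (simp_all add: V_def distrib_right)
    also have "\<dots> = c * (LINT t:{a<..<b}|lebesgue. \<rho> t)
        + (LINT t:{a<..<b}|lebesgue. (LINT s:{a<..<t}|lebesgue. (t - s) powr (1 - 1) * w s) * \<rho> t)"
      using \<rho>i kernel_Fubini(1)[OF zero_less_one w \<rho>m B] by (subst set_integral_add) auto
    also have "(LINT t:{a<..<b}|lebesgue. (LINT s:{a<..<t}|lebesgue. (t - s) powr (1 - 1) * w s) * \<rho> t)
        = (LINT s:{a<..<b}|lebesgue. w s * (LINT t:{s<..<b}|lebesgue. (t - s) powr (1 - 1) * \<rho> t))"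
      by (rule kernel_Fubini(2)[OF zero_less_one w \<rho>m B])
    also have "\<dots> = (LINT s:{a<..<b}|lebesgue. - (w s * \<xi> s))"
    proof (rule set_lebesgue_integral_cong)
      have "(LINT t:{s<..<b}|lebesgue. (t - s) powr (1 - 1) * \<rho> t) = (LINT t:{s<..<b}|lebesgue. \<rho> t)" for s
        by (rule set_lebesgue_integral_cong) auto
      then show "\<forall>s. s \<in> {a<..<b} \<longrightarrow> w s * (LINT t:{s<..<b}|lebesgue. (t - s) powr (1 - 1) * \<rho> t) = - (w s * \<xi> s)"
        using C1(2) by simp
    qed simp
    also have "(LINT t:{a<..<b}|lebesgue. \<rho> t) = - \<xi> a" using C1(2) \<open>a < b\<close> by simp
    finally have "gen_deriv a b V \<xi> = (LINT s:{a<..<b}|lebesgue. w s * \<xi> s)"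
      by (simp add: gen_deriv_def Lim set_lebesgue_integral_def)
    also have "\<dots> = (LINT t:{a<..<b}|lebesgue. rl_integral a \<delta> w t * \<psi> t)"
    proof (cases "\<delta> = 0")
      case False
      then have "\<delta> > 0" using \<delta> by simp
      have "(LINT s:{a<..<b}|lebesgue. w s * \<xi> s) =
          1 / Gamma \<delta> * (LINT s:{a<..<b}|lebesgue. w s * (LINT t:{s<..<b}|lebesgue. (t - s) powr (\<delta> - 1) * \<psi> t))"
        unfolding set_integral_mult_right[symmetric]
        using False by (simp add: \<xi>_def rl_integral_right_def)
      also have "\<dots> = 1 / Gamma \<delta> * (LINT t:{a<..<b}|lebesgue. (LINT s:{a<..<t}|lebesgue. (t - s) powr (\<delta> - 1) * w s) * \<psi> t)"
        by (subst kernel_Fubini(2)[OF \<open>\<delta> > 0\<close> w \<psi>m B']) auto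
      also have "\<dots> = (LINT t:{a<..<b}|lebesgue. rl_integral a \<delta> w t * \<psi> t)"
        unfolding set_integral_mult_right[symmetric]
        using False by (simp add: rl_integral_def)
      finally show ?thesis .
    qed (simp add: \<xi>_def rl_integral_def rl_integral_right_def)
    finally show ?thesis
      by (simp add: hilfer_deriv_def gen_rl_integral_def V_def \<xi>_def \<delta>_def)
  qed
  ultimately show ?thesis
    using g Vlim unfolding has_hilfer_deriv_def V_def \<delta>_def by blast
qed

end

theory Submission
  imports Defs
begin

text \<open>
  With \<open>y t = (t - a) powr (1 - \<gamma>) * x t\<close> the problem becomes the fixed point equation of a Picard
  operator on the measurable functions with values in the interval of radius \<open>b\<close> around \<open>x0\<close>. Its
  \<open>n\<close>-th iterate has a Lipschitz constant given by a product of Beta values \<open>B(\<alpha>, k + 1 + j\<sigma>)\<close>,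
  \<open>\<sigma> = \<mu> + k > 0\<close>; these tend to \<open>0\<close>, so the iterates converge and the fixed point is unique.

  The initial value problem in weak form is equivalent to the integral equation: by duality all
  fractional integrals can be moved to the test function, where they form a semigroup. Testing with
  \<open>rl_integral_right b \<alpha> \<psi>\<close> instead of \<open>\<psi>\<close> shows that the integral equation holds in the sense of
  distributions, hence everywhere by continuity.
\<close>

subsection \<open>Integrals with weakly singular kernels\<close>

text \<open>As k may be negative, the right-hand side and its Lipschitz bound may blow up at a while
  the kernel blows up at t; moreover A is arbitrary, so the operator need not be a contraction in
  the sup norm. Differences are therefore measured against powers of \<open>t - a\<close>. One
  application of the operator turns \<open>(t - a) powr p\<close> into a multiple of
  \<open>(t - a) powr (p + \<sigma>)\<close>: integration raises the exponent k + p by \<alpha>, and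
  the weight adds 1 - \<gamma>. Positivity of \<sigma> is exactly the assumption on k. The same
  computation with p = 0 and the bound M explains l: it ensures \<open>M * Beta \<alpha> (k + 1) /
  Gamma \<alpha> * l powr \<sigma> \<le> b\<close>, so the operator keeps values in the interval.

  In the weak problem the initial value sits in the boundary term at a, which test functions see
  because they need not vanish there. The weighted limit x0 of x becomes the limit
  \<open>x0 * Gamma \<gamma>\<close> of its integral of order 1 - \<gamma>, and the semigroup law
  matches this boundary term with the summand \<open>x0 * (t - a) powr (\<gamma> - 1)\<close> of the
  integral equation.\<close>

lemma Beta_kernel:
  fixes p q a t :: real
  assumes "p > 0" "q > 0" "a < t"
  shows "set_integrable lebesgue {a<..<t} (\<lambda>s. (t - s) powr (p - 1) * (s - a) powr (q - 1))"
    and "(LINT s:{a<..<t}|lebesgue. (t - s) powr (p - 1) * (s - a) powr (q - 1)) =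
         Beta p q * (t - a) powr (p + q - 1)"
proof -
  define m where "m = 1 / (t - a)"
  have m: "m > 0" using assms by (simp add: m_def)
  have "((\<lambda>x. (m * x + (- (a * m))) powr (q - 1) * (1 - (m * x + (- (a * m)))) powr (p - 1))
      has_integral (Beta q p /\<^sub>R m)) {(0 + a * m) /\<^sub>R m..(1 + a * m) /\<^sub>R m}"
    using has_integral_affinity'[of "\<lambda>t. t powr (q - 1) * (1 - t) powr (p - 1)" "Beta q p" 0 1 m "- (a * m)"]
      has_integral_Beta_real[of q p] assms m by simp
  also have "{(0 + a * m) /\<^sub>R m..(1 + a * m) /\<^sub>R m} = {a..t}"
    using m assms(3) by (simp add: m_def divide_simps)
  \<comment> \<open>This factor undoes the scaling of the two normalised powers; division by m
    supplies one more power of \<open>t - a\<close>.\<close>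
  finally have "((\<lambda>s. (t - a) powr (p + q - 2) *
      ((m * s + (- (a * m))) powr (q - 1) * (1 - (m * s + (- (a * m)))) powr (p - 1)))
      has_integral ((t - a) powr (p + q - 2) * (Beta q p /\<^sub>R m))) {a..t}"
    by (rule has_integral_mult_right)
  also have "(t - a) powr (p + q - 2) * (Beta q p /\<^sub>R m) = Beta p q * (t - a) powr (p + q - 1)"
  proof -
    have "(t - a) powr (p + q - 1) = (t - a) powr (p + q - 2) * (t - a)"
      using assms(3) powr_add[of "t - a" "p + q - 2" 1] by simp
    then show ?thesis by (simp add: m_def Beta_commute[of p q])
  qed
  finally have *: "((\<lambda>s. (t - s) powr (p - 1) * (s - a) powr (q - 1))
      has_integral (Beta p q * (t - a) powr (p + q - 1))) {a..t}"
  proof (rule has_integral_eq[rotated])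
    fix s assume s: "s \<in> {a..t}"
    have 1: "m * s + (- (a * m)) = (s - a) / (t - a)" by (simp add: m_def diff_divide_distrib)
    have 2: "1 - (s - a) / (t - a) = (t - s) / (t - a)" using assms(3) by (simp add: field_simps)
    have "(t - a) powr (p + q - 2) = (t - a) powr (p - 1) * (t - a) powr (q - 1)"
      by (simp add: powr_add[symmetric] algebra_simps)
    then show "(t - a) powr (p + q - 2) *
        ((m * s + (- (a * m))) powr (q - 1) * (1 - (m * s + (- (a * m)))) powr (p - 1))
        = (t - s) powr (p - 1) * (s - a) powr (q - 1)"
      unfolding 1 2 using s assms(3) by (simp add: powr_divide)
  qed
  have ai: "(\<lambda>s. (t - s) powr (p - 1) * (s - a) powr (q - 1)) absolutely_integrable_on {a..t}"
    by (rule nonnegative_absolutely_integrable_1) (use * in \<open>auto simp: has_integral_iff\<close>)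
  show "set_integrable lebesgue {a<..<t} (\<lambda>s. (t - s) powr (p - 1) * (s - a) powr (q - 1))"
    using ai by (rule set_integrable_open_real)
  show "(LINT s:{a<..<t}|lebesgue. (t - s) powr (p - 1) * (s - a) powr (q - 1)) =
      Beta p q * (t - a) powr (p + q - 1)"
    using set_integrable_open_real(2)[OF ai] * by (simp add: has_integral_iff)
qed

lemma Beta_real_pos: "p > 0 \<Longrightarrow> q > 0 \<Longrightarrow> Beta p (q :: real) > 0"
  by (simp add: Beta_def)

text \<open>Dominated convergence in the integral representation: on (0,1) the factor
  \<open>s powr (n * \<sigma>)\<close> tends to 0 and is at most 1, so the integrand for n = 0 is a
  majorant.\<close>

lemma Beta_arith_tendsto_0:
  fixes p q \<sigma> :: real
  assumes "p > 0" "q > 0" "\<sigma> > 0"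
  shows "(\<lambda>n. Beta p (q + real n * \<sigma>)) \<longlonglongrightarrow> 0"
proof -
  define K where "K = (\<lambda>n s. indicat_real {0<..<1} s * ((1 - s) powr (p - 1) * (s - 0) powr (q + real n * \<sigma> - 1)))"
  have "(\<lambda>n. LINT s|lebesgue. K n s) \<longlonglongrightarrow> (LINT s|(lebesgue :: real measure). 0)"
  proof (rule integral_dominated_convergence[where w = "K 0"])
    have K: "integrable lebesgue (K n)" for n
      using Beta_kernel(1)[of p "q + real n * \<sigma>" 0 1] assms
      by (simp add: K_def set_integrable_def add_pos_nonneg)
    then show "integrable lebesgue (K 0)" "K n \<in> borel_measurable lebesgue" for n by auto
    show "AE s in lebesgue. (\<lambda>n. K n s) \<longlonglongrightarrow> 0"
    proof (rule AE_I2)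
      fix s :: real
      show "(\<lambda>n. K n s) \<longlonglongrightarrow> 0"
      proof (cases "s \<in> {0<..<1}")
        case True
        have "s powr (q + real n * \<sigma> - 1) = s powr (q - 1) * (s powr \<sigma>) ^ n" for n
          using True by (simp add: powr_realpow[symmetric] powr_powr powr_add[symmetric] algebra_simps)
        moreover have "(\<lambda>n. (1 - s) powr (p - 1) * (s powr (q - 1) * (s powr \<sigma>) ^ n)) \<longlonglongrightarrow> (1 - s) powr (p - 1) * (s powr (q - 1) * 0)"
          using True assms powr_less_mono2[of \<sigma> s 1] by (intro tendsto_intros LIMSEQ_realpow_zero) auto
        ultimately show ?thesis using True by (simp add: K_def)
      qed (auto simp: K_def)
    qed
    show "AE s in lebesgue. norm (K n s) \<le> K 0 s" for n
      using assms by (intro AE_I2) (auto simp: K_def indicator_def intro!: mult_left_mono powr_mono')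
  qed simp
  moreover have "(LINT s|lebesgue. K n s) = Beta p (q + real n * \<sigma>)" for n
    using Beta_kernel(2)[of p "q + real n * \<sigma>" 0 1] assms
    by (simp add: K_def set_lebesgue_integral_def add_pos_nonneg)
  ultimately show ?thesis by simp
qed

lemma borel_measurable_ident_lebesgue [measurable]:
  "(\<lambda>x. x) \<in> lebesgue \<rightarrow>\<^sub>M (borel :: real measure)"
  by (simp add: measurable_completion)

text \<open>The Beta kernel is the majorant. It serves for right-hand sides (q = k + 1), their
  differences (q = k + 1 + p), functions of the size of solutions (q = \<gamma>) and, with first
  exponent 1, for plain integrability.\<close>

lemma rl_kernel_bound:
  fixes u :: "real \<Rightarrow> real"
  assumes pq: "p > 0" "q > 0" "a < t" and u: "set_borel_measurable lebesgue {a<..<t} u"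
    and M: "\<And>s. s \<in> {a<..<t} \<Longrightarrow> \<bar>u s\<bar> \<le> M * (s - a) powr (q - 1)"
  shows "set_integrable lebesgue {a<..<t} (\<lambda>s. (t - s) powr (p - 1) * u s)"
    and "\<bar>LINT s:{a<..<t}|lebesgue. (t - s) powr (p - 1) * u s\<bar> \<le> M * (Beta p q * (t - a) powr (p + q - 1))"
proof -
  let ?K = "\<lambda>s. (t - s) powr (p - 1) * (s - a) powr (q - 1)"
  have K: "set_integrable lebesgue {a<..<t} (\<lambda>s. M * ?K s)"
    using Beta_kernel(1)[OF pq] by simp
  have le: "\<bar>(t - s) powr (p - 1) * u s\<bar> \<le> M * ?K s" if "s \<in> {a<..<t}" for s
    using mult_left_mono[OF M[OF that], of "(t - s) powr (p - 1)"] by (simp add: abs_mult mult_ac)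
  show i: "set_integrable lebesgue {a<..<t} (\<lambda>s. (t - s) powr (p - 1) * u s)"
  proof (rule set_integrable_bound[OF K])
    have "(\<lambda>s. (t - s) powr (p - 1) * (indicator {a<..<t} s *\<^sub>R u s)) \<in> borel_measurable lebesgue"
      using u unfolding set_borel_measurable_def by measurable
    then show "set_borel_measurable lebesgue {a<..<t} (\<lambda>s. (t - s) powr (p - 1) * u s)"
      unfolding set_borel_measurable_def by (simp add: mult_ac)
    show "AE s in lebesgue. s \<in> {a<..<t} \<longrightarrow> norm ((t - s) powr (p - 1) * u s) \<le> norm (M * ?K s)"
      using le by (intro AE_I2) (metis abs_ge_self order_trans real_norm_def)
  qed
  have "\<bar>LINT s:{a<..<t}|lebesgue. (t - s) powr (p - 1) * u s\<bar> \<le> (LINT s:{a<..<t}|lebesgue. \<bar>(t - s) powr (p - 1) * u s\<bar>)"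
    using set_integral_norm_bound[OF i] by simp
  also have "\<dots> \<le> (LINT s:{a<..<t}|lebesgue. M * ?K s)"
    by (intro set_integral_mono set_integrable_abs i K le)
  also have "\<dots> = M * (Beta p q * (t - a) powr (p + q - 1))"
    using Beta_kernel(2)[OF pq] by simp
  finally show "\<bar>LINT s:{a<..<t}|lebesgue. (t - s) powr (p - 1) * u s\<bar> \<le> M * (Beta p q * (t - a) powr (p + q - 1))" .
qed

text \<open>
  The majorants \<open>(t\<^sub>n - s) powr (p - 1) * (s - a) powr (q - 1)\<close> have no common integrable bound, but
  their integrals are known to converge; hence Scheffe's lemma instead of dominated convergence.
\<close>

lemma continuous_on_rl_kernel:
  fixes u :: "real \<Rightarrow> real"
  assumes pq: "p > 0" "q > 0" and u: "set_borel_measurable lebesgue {a<..<b} u"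
    and M: "\<And>s. s \<in> {a<..<b} \<Longrightarrow> \<bar>u s\<bar> \<le> M * (s - a) powr (q - 1)"
  shows "continuous_on {a<..b} (\<lambda>t. LINT s:{a<..<t}|lebesgue. (t - s) powr (p - 1) * u s)"
proof (rule continuous_on_sequentiallyI)
  fix S :: "nat \<Rightarrow> real" and t
  assume S: "\<forall>n. S n \<in> {a<..b}" and t: "t \<in> {a<..b}" and lim: "S \<longlonglongrightarrow> t"
  \<comment> \<open>The interval is nonempty because t lies in \<open>{a<..b}\<close>; the bound at
    its midpoint forces the sign of M.\<close>
  have M0: "M \<ge> 0"
  proof -
    have "0 \<le> M * ((a + b) / 2 - a) powr (q - 1)"
      using t by (intro order_trans[OF abs_ge_zero M]) auto
    moreover have "((a + b) / 2 - a) powr (q - 1) > 0" using t by auto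
    ultimately show ?thesis by (simp add: zero_le_mult_iff)
  qed
  define K where "K = (\<lambda>t s. indicat_real {a<..<t} s * ((t - s) powr (p - 1) * (s - a) powr (q - 1)))"
  define J where "J = (\<lambda>t s. indicat_real {a<..<t} s * ((t - s) powr (p - 1) * u s))"
  have Ki: "integrable lebesgue (K t)" and KI: "(LINT s|lebesgue. K t s) = Beta p q * (t - a) powr (p + q - 1)"
    if "t > a" for t
    using Beta_kernel[OF pq that] by (simp_all add: K_def set_integrable_def set_lebesgue_integral_def)
  have Ji: "integrable lebesgue (J t)" if "t \<in> {a<..b}" for t
    unfolding J_def using that
    by (intro rl_kernel_bound(1)[where M = M, OF pq, unfolded set_integrable_def, simplified] M
        set_borel_measurable_subset[OF u]) auto
  have K0: "K t s \<ge> 0" for t s by (simp add: K_def)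
  have n: "(\<integral>\<^sup>+s. norm (K t s) \<partial>lebesgue) = ennreal (Beta p q * (t - a) powr (p + q - 1))" if "t > a" for t
    using nn_integral_eq_integral[OF Ki[OF that]] KI[OF that] K0 by simp
  have "(\<lambda>n. \<integral>\<^sup>+s. norm (K (S n) s - K t s) \<partial>lebesgue) \<longlonglongrightarrow> 0"
  proof (rule Scheffe_lemma1)
    show "AE s in lebesgue. (\<lambda>n. K (S n) s) \<longlonglongrightarrow> K t s"
    proof (rule AE_mp[OF AE_completion[OF AE_lborel_singleton[of t]]], intro AE_I2 impI)
      \<comment> \<open>For p < 1 the kernels can be unbounded along S at s = t, so this point is
        left out.\<close>
      fix s assume "s \<noteq> t"
      then consider "s \<le> a" | "a < s" "s < t" | "s > t" by linarith
      then show "(\<lambda>n. K (S n) s) \<longlonglongrightarrow> K t s"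
      proof cases
        case 2
        then have "\<forall>\<^sub>F n in sequentially. K (S n) s = (S n - s) powr (p - 1) * (s - a) powr (q - 1)"
          using order_tendstoD(1)[OF lim, of s] by (auto elim!: eventually_mono simp: K_def)
        moreover have "(\<lambda>n. (S n - s) powr (p - 1) * (s - a) powr (q - 1)) \<longlonglongrightarrow> (t - s) powr (p - 1) * (s - a) powr (q - 1)"
          using 2 by (intro tendsto_intros lim) auto
        moreover have "K t s = (t - s) powr (p - 1) * (s - a) powr (q - 1)" using 2 by (simp add: K_def)
        ultimately show ?thesis by (simp add: tendsto_cong)
      next
        case 3
        then have "\<forall>\<^sub>F n in sequentially. K (S n) s = 0"
          using order_tendstoD(2)[OF lim, of s] by (auto elim!: eventually_mono simp: K_def)
        then show ?thesis using 3 by (auto simp: K_def intro: tendsto_eventually)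
      qed (simp add: K_def)
    qed
    have "(\<lambda>n. ennreal (Beta p q * (S n - a) powr (p + q - 1))) \<longlonglongrightarrow> ennreal (Beta p q * (t - a) powr (p + q - 1))"
      using t by (intro tendsto_intros lim) auto
    moreover have "ennreal (Beta p q * (S n - a) powr (p + q - 1)) = (\<integral>\<^sup>+s. norm (K (S n) s) \<partial>lebesgue)" for n
      using n S by simp
    ultimately have "(\<lambda>n. \<integral>\<^sup>+s. norm (K (S n) s) \<partial>lebesgue) \<longlonglongrightarrow> (\<integral>\<^sup>+s. norm (K t s) \<partial>lebesgue)"
      using n[of t] t by simp
    then show "limsup (\<lambda>n. \<integral>\<^sup>+s. norm (K (S n) s) \<partial>lebesgue) \<le> (\<integral>\<^sup>+s. norm (K t s) \<partial>lebesgue)"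
      by (simp add: lim_imp_Limsup)
  qed (use S t Ki in auto)
  moreover have "(\<integral>\<^sup>+s. norm (K (S n) s - K t s) \<partial>lebesgue) = ennreal (LINT s|lebesgue. \<bar>K (S n) s - K t s\<bar>)" for n
    using S t Ki by (subst nn_integral_eq_integral) auto
  ultimately have "(\<lambda>n. ennreal (LINT s|lebesgue. \<bar>K (S n) s - K t s\<bar>)) \<longlonglongrightarrow> ennreal 0" by simp
  then have L: "(\<lambda>n. LINT s|lebesgue. \<bar>K (S n) s - K t s\<bar>) \<longlonglongrightarrow> 0"
    by (subst (asm) tendsto_ennreal_iff) auto
  have le: "\<bar>(LINT s|lebesgue. J (S n) s) - (LINT s|lebesgue. J t s)\<bar> \<le> M * (LINT s|lebesgue. \<bar>K (S n) s - K t s\<bar>)" for n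
  proof -
    have JJ: "integrable lebesgue (J (S n))" "integrable lebesgue (J t)" using S t Ji by auto
    have KK: "integrable lebesgue (K (S n))" "integrable lebesgue (K t)" using S t Ki by auto
    have "\<bar>(LINT s|lebesgue. J (S n) s) - (LINT s|lebesgue. J t s)\<bar> = \<bar>LINT s|lebesgue. J (S n) s - J t s\<bar>"
      using JJ by simp
    also have "\<dots> \<le> (LINT s|lebesgue. \<bar>J (S n) s - J t s\<bar>)"
      using integral_norm_bound[of lebesgue "\<lambda>s. J (S n) s - J t s"] by simp
    also have "\<dots> \<le> (LINT s|lebesgue. M * \<bar>K (S n) s - K t s\<bar>)"
    proof (rule integral_mono)
      fix s
      \<comment> \<open>Both differences are d times a function of s alone, so the pointwise bound
        on u carries over, whichever of \<open>S n\<close> and t is larger.\<close>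
      define d where "d = indicat_real {a<..<S n} s * (S n - s) powr (p - 1) - indicat_real {a<..<t} s * (t - s) powr (p - 1)"
      have d: "J (S n) s - J t s = d * u s" "K (S n) s - K t s = d * (s - a) powr (q - 1)"
        by (simp_all add: d_def J_def K_def algebra_simps)
      show "\<bar>J (S n) s - J t s\<bar> \<le> M * \<bar>K (S n) s - K t s\<bar>"
      proof (cases "s \<in> {a<..<b}")
        case True
        then show ?thesis unfolding d abs_mult using mult_left_mono[OF M[OF True], of "\<bar>d\<bar>"] by (simp add: mult_ac)
      next
        case False
        then have "s \<notin> {a<..<S n}" "s \<notin> {a<..<t}"
          using t S[rule_format, of n] by auto
        then have "d = 0" by (simp add: d_def)
        then show ?thesis unfolding d by simp
      qed
    qed (use JJ KK in auto)
    finally show ?thesis by simp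
  qed
  have "(\<lambda>n. (LINT s|lebesgue. J (S n) s) - (LINT s|lebesgue. J t s)) \<longlonglongrightarrow> 0"
  proof (rule Lim_null_comparison)
    show "\<forall>\<^sub>F n in sequentially. norm ((LINT s|lebesgue. J (S n) s) - (LINT s|lebesgue. J t s)) \<le> M * (LINT s|lebesgue. \<bar>K (S n) s - K t s\<bar>)"
      using le by simp
    show "(\<lambda>n. M * (LINT s|lebesgue. \<bar>K (S n) s - K t s\<bar>)) \<longlonglongrightarrow> 0"
      using tendsto_mult_right_zero[OF L] by simp
  qed
  then show "(\<lambda>n. LINT s:{a<..<S n}|lebesgue. (S n - s) powr (p - 1) * u s) \<longlonglongrightarrow> (LINT s:{a<..<t}|lebesgue. (t - s) powr (p - 1) * u s)"
    by (subst LIM_zero_iff[symmetric]) (simp add: J_def set_lebesgue_integral_def)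
qed

subsection \<open>The weak Hilfer derivative and the integral equation\<close>

text \<open>A class that contains a test function together with its derivative and is closed under
  right-sided integrals; continuity suffices for duality and the semigroup law.\<close>

definition vanishing_near :: "real \<Rightarrow> (real \<Rightarrow> real) \<Rightarrow> bool" where
  "vanishing_near b p \<longleftrightarrow> continuous_on UNIV p \<and> (\<exists>r<b. \<forall>t\<ge>r. p t = 0)"

lemma vanishing_near_rl_integral_right:
  assumes "\<delta> \<ge> 0" "vanishing_near b p"
  shows "vanishing_near b (rl_integral_right b \<delta> p)"
proof (cases "\<delta> = 0")
  case False
  then have \<delta>: "\<delta> > 0" using assms by simp
  obtain r where r: "r < b" "\<And>t. t \<ge> r \<Longrightarrow> p t = 0" and c: "continuous_on UNIV p"
    using assms(2) by (auto simp: vanishing_near_def)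
  have "rl_integral_right b \<delta> p t = 0" if "t \<ge> r" for t
  proof -
    have "(LINT s:{t<..<b}|lebesgue. (s - t) powr (\<delta> - 1) * p s) = (LINT s:{t<..<b}|lebesgue. 0)"
      using that r(2) by (intro set_lebesgue_integral_cong) auto
    then show ?thesis by (simp add: rl_integral_right_def False)
  qed
  then show ?thesis
    using continuous_rl_integral_right[OF \<delta> c r] r(1) unfolding vanishing_near_def by blast
qed (use assms in \<open>simp add: rl_integral_right_def[abs_def]\<close>)

lemma vanishing_near_measurable: "vanishing_near b p \<Longrightarrow> p \<in> borel_measurable borel"
  by (simp add: vanishing_near_def borel_measurable_continuous_onI)

lemma vanishing_near_bounded:
  assumes "vanishing_near b p"
  obtains B where "\<And>t. t \<in> {a<..<b} \<Longrightarrow> \<bar>p t\<bar> \<le> B"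
  using assms bounded_on_Ioo unfolding vanishing_near_def by metis

lemma set_integrable_mult_vanishing_near:
  assumes w: "set_integrable lebesgue {a<..<b} w" and p: "vanishing_near b p"
  shows "set_integrable lebesgue {a<..<b} (\<lambda>t. w t * p t)"
proof -
  obtain B where B: "\<And>t. t \<in> {a<..<b} \<Longrightarrow> \<bar>p t\<bar> \<le> B" using vanishing_near_bounded[OF p] by blast
  have [measurable]: "p \<in> borel_measurable borel" by (rule vanishing_near_measurable[OF p])
  have i: "integrable lebesgue (\<lambda>t. indicat_real {a<..<b} t * w t)"
    using w by (simp add: set_integrable_def)
  then have [measurable]: "(\<lambda>t. indicat_real {a<..<b} t * w t) \<in> borel_measurable lebesgue" by auto
  have "integrable lebesgue (\<lambda>t. (indicat_real {a<..<b} t * w t) * p t)"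
  proof (rule Bochner_Integration.integrable_bound[OF integrable_mult_right[OF i, of B]])
    show "AE t in lebesgue. norm (indicat_real {a<..<b} t * w t * p t) \<le> norm (B * (indicat_real {a<..<b} t * w t))"
    proof (rule AE_I2)
      fix t
      show "norm (indicat_real {a<..<b} t * w t * p t) \<le> norm (B * (indicat_real {a<..<b} t * w t))"
        using mult_left_mono[OF order_trans[OF B abs_ge_self], of t "\<bar>w t\<bar>"]
        by (auto simp: indicator_def abs_mult mult.commute)
    qed
  qed measurable
  then show ?thesis by (simp add: set_integrable_def mult.assoc)
qed

text \<open>Exchanging the order of integration leaves an inner Beta integral, and
  \<open>Beta q p / (Gamma p * Gamma q)\<close> is \<open>1 / Gamma (p + q)\<close>.
  \<open>kernel_Fubini\<close> is read backwards, with the power function based at t as its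
  integrable factor.\<close>

lemma rl_integral_right_add:
  assumes "p \<ge> 0" "q \<ge> 0" and g: "vanishing_near b g" and t: "t < b"
  shows "rl_integral_right b p (rl_integral_right b q g) t = rl_integral_right b (p + q) g t"
proof (cases "p = 0 \<or> q = 0")
  case True
  then show ?thesis by (auto simp: rl_integral_right_def[abs_def])
next
  case False
  with assms have pq: "p > 0" "q > 0" by auto
  obtain B where B: "\<And>s. s \<in> {t<..<b} \<Longrightarrow> \<bar>g s\<bar> \<le> B" using vanishing_near_bounded[OF g] by blast
  have "(LINT s:{t<..<b}|lebesgue. (s - t) powr (p - 1) * rl_integral_right b q g s)
      = 1 / Gamma q * (LINT s:{t<..<b}|lebesgue. (s - t) powr (p - 1) * (LINT r:{s<..<b}|lebesgue. (r - s) powr (q - 1) * g r))"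
    unfolding set_integral_mult_right[symmetric] using pq by (simp add: rl_integral_right_def mult.left_commute)
  also have "(LINT s:{t<..<b}|lebesgue. (s - t) powr (p - 1) * (LINT r:{s<..<b}|lebesgue. (r - s) powr (q - 1) * g r))
      = (LINT r:{t<..<b}|lebesgue. (LINT s:{t<..<r}|lebesgue. (r - s) powr (q - 1) * (s - t) powr (p - 1)) * g r)"
    using t by (intro kernel_Fubini(2)[symmetric, where B = B] pq kernel_right(1) B vanishing_near_measurable[OF g]) auto
  also have "\<dots> = (LINT r:{t<..<b}|lebesgue. Beta q p * ((r - t) powr (p + q - 1) * g r))"
    using Beta_kernel(2)[OF pq(2,1), of t]
    by (intro set_lebesgue_integral_cong) (simp_all add: add.commute)
  finally have "(LINT s:{t<..<b}|lebesgue. (s - t) powr (p - 1) * rl_integral_right b q g s)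
      = 1 / Gamma q * (Beta p q * (LINT r:{t<..<b}|lebesgue. (r - t) powr (p + q - 1) * g r))"
    by (simp add: Beta_commute)
  moreover have "Gamma p \<noteq> 0" "Gamma q \<noteq> 0"
    using Gamma_real_pos[OF pq(1)] Gamma_real_pos[OF pq(2)] by linarith+
  ultimately show ?thesis
    using pq by (simp add: rl_integral_right_def Beta_def)
qed

text \<open>Fractional integration by parts: \<open>kernel_Fubini\<close> up to the Gamma factor,
  with order 0 treated apart because the kernel formula does not cover it.\<close>

lemma rl_integral_duality:
  assumes "\<delta> \<ge> 0" and w: "set_integrable lebesgue {a<..<b} w" and g: "vanishing_near b g"
  shows "set_integrable lebesgue {a<..<b} (\<lambda>t. rl_integral a \<delta> w t * g t)"
    and "(LINT t:{a<..<b}|lebesgue. rl_integral a \<delta> w t * g t) =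
         (LINT t:{a<..<b}|lebesgue. w t * rl_integral_right b \<delta> g t)"
proof -
  obtain B where B: "\<And>s. s \<in> {a<..<b} \<Longrightarrow> \<bar>g s\<bar> \<le> B" using vanishing_near_bounded[OF g] by blast
  note m = vanishing_near_measurable[OF g]
  show "set_integrable lebesgue {a<..<b} (\<lambda>t. rl_integral a \<delta> w t * g t)"
  proof (cases "\<delta> = 0")
    case False
    then have "set_integrable lebesgue {a<..<b} (\<lambda>t. 1 / Gamma \<delta> * ((LINT s:{a<..<t}|lebesgue. (t - s) powr (\<delta> - 1) * w s) * g t))"
      using assms(1) by (intro set_integrable_mult_right kernel_Fubini(1)[OF _ w m B]) auto
    then show ?thesis using False by (simp add: rl_integral_def)
  qed (use set_integrable_mult_vanishing_near[OF w g] in \<open>simp add: rl_integral_def\<close>)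
  show "(LINT t:{a<..<b}|lebesgue. rl_integral a \<delta> w t * g t) =
      (LINT t:{a<..<b}|lebesgue. w t * rl_integral_right b \<delta> g t)"
  proof (cases "\<delta> = 0")
    case False
    then have \<delta>: "\<delta> > 0" using assms(1) by simp
    have "(LINT t:{a<..<b}|lebesgue. rl_integral a \<delta> w t * g t) =
        1 / Gamma \<delta> * (LINT t:{a<..<b}|lebesgue. (LINT s:{a<..<t}|lebesgue. (t - s) powr (\<delta> - 1) * w s) * g t)"
      unfolding set_integral_mult_right[symmetric] using False by (simp add: rl_integral_def)
    also have "\<dots> = 1 / Gamma \<delta> * (LINT s:{a<..<b}|lebesgue. w s * (LINT t:{s<..<b}|lebesgue. (t - s) powr (\<delta> - 1) * g t))"
      by (subst kernel_Fubini(2)[OF \<delta> w m B]) auto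
    also have "\<dots> = (LINT t:{a<..<b}|lebesgue. w t * rl_integral_right b \<delta> g t)"
      unfolding set_integral_mult_right[symmetric] using False by (simp add: rl_integral_right_def mult.left_commute)
    finally show ?thesis .
  qed (simp add: rl_integral_def rl_integral_right_def)
qed

lemma test_function_derivE:
  assumes "test_function b \<psi>"
  obtains D where "\<And>t. (\<psi> has_real_derivative D t) (at t)" "vanishing_near b \<psi>" "vanishing_near b D"
proof -
  obtain D r where D: "\<And>t. (\<psi> has_real_derivative D t) (at t)" "continuous_on UNIV D"
    "r < b" "\<And>t. t \<ge> r \<Longrightarrow> \<psi> t = 0" "\<And>t. t \<ge> r \<Longrightarrow> D t = 0"
    using test_functionE[OF assms] by metis
  then have "continuous_on UNIV \<psi>" by (meson DERIV_isCont continuous_at_imp_continuous_on)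
  with D show ?thesis by (intro that[of D]) (auto simp: vanishing_near_def)
qed

text \<open>Writing a test function as a right integral of order 1 of its derivative lets
  differentiation take part in the addition of orders. The sign appears because integration runs
  towards b, where \<psi> vanishes.\<close>

lemma rl_integral_right_1_deriv:
  assumes "\<And>t. (\<psi> has_real_derivative D t) (at t)" "vanishing_near b \<psi>" "vanishing_near b D" "t < b"
  shows "rl_integral_right b 1 D t = - \<psi> t"
proof -
  have "\<psi> b = 0" using assms(2) by (auto simp: vanishing_near_def)
  moreover have "(LINT s:{t<..<b}|lebesgue. (s - t) powr (1 - 1) * D s) = (LINT s:{t<..<b}|lebesgue. D s)"
    by (intro set_lebesgue_integral_cong) auto
  ultimately show ?thesis
    using C1_eq_integral(2)[OF assms(1), of b t] assms(3,4) by (simp add: rl_integral_right_def vanishing_near_def)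
qed

text \<open>Test functions are differentiable on the whole line, so
  \<open>rl_integral_right_C1\<close> is extended past b, where both functions vanish.\<close>

lemma rl_integral_right_has_deriv:
  assumes "\<delta> \<ge> 0" and D: "\<And>t. (\<psi> has_real_derivative D t) (at t)"
    and v: "vanishing_near b \<psi>" "vanishing_near b D"
  shows "(rl_integral_right b \<delta> \<psi> has_real_derivative rl_integral_right b \<delta> D t) (at t)"
proof (cases "t < b")
  case True
  obtain r1 r2 where r: "r1 < b" "\<And>t. t \<ge> r1 \<Longrightarrow> \<psi> t = 0" "r2 < b" "\<And>t. t \<ge> r2 \<Longrightarrow> D t = 0"
    using v unfolding vanishing_near_def by blast
  then show ?thesis
    using v rl_integral_right_C1(3)[OF \<open>\<delta> \<ge> 0\<close> D, of "max r1 r2" b t] True by (simp add: vanishing_near_def)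
next
  case False
  obtain r where r: "r < b" "\<And>s. s \<ge> r \<Longrightarrow> rl_integral_right b \<delta> \<psi> s = 0"
    using vanishing_near_rl_integral_right[OF assms(1) v(1)] unfolding vanishing_near_def by blast
  obtain r' where r': "r' < b" "\<And>s. s \<ge> r' \<Longrightarrow> rl_integral_right b \<delta> D s = 0"
    using vanishing_near_rl_integral_right[OF assms(1) v(2)] unfolding vanishing_near_def by blast
  have "\<forall>\<^sub>F s in nhds t. rl_integral_right b \<delta> \<psi> s = 0"
    using eventually_nhds_in_open[of "{r<..}" t] r False by (auto elim!: eventually_mono)
  then show ?thesis using r'(2)[of t] r'(1) False
    by (subst DERIV_cong_ev[OF refl _ refl, of _ "\<lambda>_. 0"]) auto
qed

lemma test_functionI:
  assumes "\<And>t. (\<psi> has_real_derivative D t) (at t)" "vanishing_near b \<psi>" "vanishing_near b D"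
  shows "test_function b \<psi>"
  using assms unfolding test_function_def C1_differentiable_on_def vanishing_near_def
    has_real_derivative_iff_has_vector_derivative by blast

text \<open>Everything is moved onto D. The outer integral and differentiation make up the boundary
  factor of order \<open>1 + \<beta> * (1 - \<alpha>)\<close>; in the other term the inner and outer
  orders add up.\<close>

lemma hilfer_deriv_test_function:
  assumes "\<alpha> \<le> 1" "0 \<le> \<beta>" "\<beta> \<le> 1" "a < b"
    and x: "set_integrable lebesgue {a<..<b} x"
    and c: "(rl_integral a ((1 - \<beta>) * (1 - \<alpha>)) x \<longlongrightarrow> c) (at_right a)"
    and D: "\<And>t. (\<psi> has_real_derivative D t) (at t)" "vanishing_near b \<psi>" "vanishing_near b D"
  shows "hilfer_deriv a b \<alpha> \<beta> x \<psi> =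
    c * rl_integral_right b (1 + \<beta> * (1 - \<alpha>)) D a
      - (LINT t:{a<..<b}|lebesgue. x t * rl_integral_right b (1 - \<alpha>) D t)"
proof -
  define \<delta> where "\<delta> = \<beta> * (1 - \<alpha>)"
  define \<eta> where "\<eta> = (1 - \<beta>) * (1 - \<alpha>)"
  have nn: "\<delta> \<ge> 0" "\<eta> \<ge> 0" using assms by (simp_all add: \<delta>_def \<eta>_def)
  \<comment> \<open>Here \<beta> cancels; the type of the derivative survives only in the boundary
    term.\<close>
  have sum: "\<eta> + \<delta> = 1 - \<alpha>" by (simp add: \<eta>_def \<delta>_def algebra_simps)
  note R = rl_integral_right_has_deriv[OF nn(1) D]
  note v = vanishing_near_rl_integral_right[OF nn(1)]
  have "- rl_integral_right b \<delta> \<psi> a = rl_integral_right b (1 + \<delta>) D a"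
    using rl_integral_right_1_deriv[OF R v[OF D(2)] v[OF D(3)] \<open>a < b\<close>]
      rl_integral_right_add[OF _ nn(1) D(3) \<open>a < b\<close>, of 1] by simp
  moreover have "(LINT t:{a<..<b}|lebesgue. rl_integral a \<eta> x t * deriv (rl_integral_right b \<delta> \<psi>) t)
      = (LINT t:{a<..<b}|lebesgue. x t * rl_integral_right b (1 - \<alpha>) D t)"
  proof -
    have "(LINT t:{a<..<b}|lebesgue. rl_integral a \<eta> x t * deriv (rl_integral_right b \<delta> \<psi>) t)
        = (LINT t:{a<..<b}|lebesgue. x t * rl_integral_right b \<eta> (rl_integral_right b \<delta> D) t)"
      using rl_integral_duality(2)[OF nn(2) x v[OF D(3)]] DERIV_imp_deriv[OF R] by simp
    also have "\<dots> = (LINT t:{a<..<b}|lebesgue. x t * rl_integral_right b (1 - \<alpha>) D t)"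
      using rl_integral_right_add[OF nn(2,1) D(3)] sum by (intro set_lebesgue_integral_cong) auto
    finally show ?thesis .
  qed
  moreover have "Lim (at_right a) (rl_integral a \<eta> x) = c" using c by (intro tendsto_Lim) (auto simp: \<eta>_def)
  ultimately show ?thesis
    by (simp add: hilfer_deriv_def gen_rl_integral_def gen_deriv_def \<delta>_def[symmetric] \<eta>_def[symmetric])
      (metis minus_mult_right)
qed

text \<open>A tested power function is a value at the left end point; this allows it to be compared
  with the boundary term of the weak derivative.\<close>

lemma integral_power_eq_rl_integral_right:
  assumes "\<gamma> > 0"
  shows "(LINT t:{a<..<b}|lebesgue. (t - a) powr (\<gamma> - 1) * p t) = Gamma \<gamma> * rl_integral_right b \<gamma> p a"
proof -
  have "Gamma \<gamma> \<noteq> 0" using Gamma_real_pos[OF assms] by linarith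
  then show ?thesis using assms by (simp add: rl_integral_right_def)
qed

text \<open>Testing the power part of x gives order
  \<open>\<gamma> + (1 - \<alpha>) = 1 + \<beta> * (1 - \<alpha>)\<close> at a, which cancels the
  boundary term. In the remaining part the orders \<alpha> and 1 - \<alpha> add up to 1, which turns
  D into -\<psi>.\<close>

lemma has_hilfer_deriv_of_integral_equation:
  fixes \<alpha> \<beta> :: real
  defines "\<gamma> \<equiv> \<alpha> + \<beta> * (1 - \<alpha>)"
  assumes \<alpha>: "0 < \<alpha>" "\<alpha> < 1" "0 \<le> \<beta>" "\<beta> \<le> 1" "a < b"
    and x: "set_integrable lebesgue {a<..<b} x"
    and u: "set_integrable lebesgue {a<..<b} u"
    and c: "(rl_integral a ((1 - \<beta>) * (1 - \<alpha>)) x \<longlongrightarrow> x0 * Gamma \<gamma>) (at_right a)"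
    and eq: "\<And>t. t \<in> {a<..<b} \<Longrightarrow> x t = x0 * (t - a) powr (\<gamma> - 1) + rl_integral a \<alpha> u t"
  shows "has_hilfer_deriv a b \<alpha> \<beta> x u"
  unfolding has_hilfer_deriv_def
proof (intro conjI allI impI x u exI[of _ "x0 * Gamma \<gamma>"] c)
  fix \<psi> assume "test_function b \<psi>"
  then obtain D where D: "\<And>t. (\<psi> has_real_derivative D t) (at t)" "vanishing_near b \<psi>" "vanishing_near b D"
    using test_function_derivE by metis
  have \<gamma>: "\<gamma> > 0" using \<alpha> by (simp add: \<gamma>_def add_pos_nonneg)
  define P where "P = rl_integral_right b (1 - \<alpha>) D"
  have P: "vanishing_near b P" using D(3) \<alpha> by (simp add: P_def vanishing_near_rl_integral_right)
  have pow: "set_integrable lebesgue {a<..<b} (\<lambda>t. (t - a) powr (\<gamma> - 1))"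
    using \<alpha> \<gamma> by (intro kernel_right(1)) auto
  have "(LINT t:{a<..<b}|lebesgue. x t * P t)
      = (LINT t:{a<..<b}|lebesgue. x0 * ((t - a) powr (\<gamma> - 1) * P t) + rl_integral a \<alpha> u t * P t)"
    using eq by (intro set_lebesgue_integral_cong) (auto simp: algebra_simps)
  also have "\<dots> = x0 * (LINT t:{a<..<b}|lebesgue. (t - a) powr (\<gamma> - 1) * P t)
      + (LINT t:{a<..<b}|lebesgue. rl_integral a \<alpha> u t * P t)"
    using \<alpha> by (subst set_integral_add)
      (auto intro!: set_integrable_mult_vanishing_near[OF pow P] rl_integral_duality(1) u P)
  also have "(LINT t:{a<..<b}|lebesgue. (t - a) powr (\<gamma> - 1) * P t) = Gamma \<gamma> * rl_integral_right b (\<gamma> + (1 - \<alpha>)) D a"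
    using rl_integral_right_add[OF _ _ D(3) \<open>a < b\<close>, of \<gamma> "1 - \<alpha>"] \<alpha> \<gamma>
    by (simp add: integral_power_eq_rl_integral_right P_def)
  also have "(LINT t:{a<..<b}|lebesgue. rl_integral a \<alpha> u t * P t) = (LINT t:{a<..<b}|lebesgue. u t * rl_integral_right b \<alpha> P t)"
    using \<alpha> by (intro rl_integral_duality(2) u P) auto
  also have "\<dots> = (LINT t:{a<..<b}|lebesgue. - (u t * \<psi> t))"
    using rl_integral_right_add[OF _ _ D(3), of \<alpha> "1 - \<alpha>"] rl_integral_right_1_deriv[OF D] \<alpha>
    by (intro set_lebesgue_integral_cong) (auto simp: P_def)
  also have "\<dots> = - (LINT t:{a<..<b}|lebesgue. u t * \<psi> t)" by (simp add: set_lebesgue_integral_def)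
  also have "\<gamma> + (1 - \<alpha>) = 1 + \<beta> * (1 - \<alpha>)" by (simp add: \<gamma>_def)
  finally show "hilfer_deriv a b \<alpha> \<beta> x \<psi> = (LINT t:{a<..<b}|lebesgue. u t * \<psi> t)"
    using hilfer_deriv_test_function[OF _ _ _ _ x c D] \<alpha> by (simp add: P_def)
qed

text \<open>
  Testing the equation with \<open>rl_integral_right b \<alpha> \<psi>\<close> in place of \<open>\<psi>\<close> applies
  \<open>rl_integral a \<alpha>\<close> to both sides.
\<close>

lemma integral_equation_tested:
  fixes \<alpha> \<beta> :: real
  defines "\<gamma> \<equiv> \<alpha> + \<beta> * (1 - \<alpha>)"
  assumes \<alpha>: "0 < \<alpha>" "\<alpha> < 1" "0 \<le> \<beta>" "\<beta> \<le> 1" "a < b"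
    and xu: "has_hilfer_deriv a b \<alpha> \<beta> x u"
    and c: "(rl_integral a ((1 - \<beta>) * (1 - \<alpha>)) x \<longlongrightarrow> x0 * Gamma \<gamma>) (at_right a)"
    and \<psi>: "test_function b \<psi>"
  shows "set_integrable lebesgue {a<..<b} (\<lambda>t. (x t - x0 * (t - a) powr (\<gamma> - 1) - rl_integral a \<alpha> u t) * \<psi> t)" 
    and "(LINT t:{a<..<b}|lebesgue. (x t - x0 * (t - a) powr (\<gamma> - 1) - rl_integral a \<alpha> u t) * \<psi> t) = 0"
proof -
  have x: "set_integrable lebesgue {a<..<b} x" and u: "set_integrable lebesgue {a<..<b} u"
    using xu by (auto simp: has_hilfer_deriv_def)
  obtain D where D: "\<And>t. (\<psi> has_real_derivative D t) (at t)" "vanishing_near b \<psi>" "vanishing_near b D"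
    using test_function_derivE[OF \<psi>] by metis
  have \<gamma>: "\<gamma> > 0" using \<alpha> by (simp add: \<gamma>_def add_pos_nonneg)
  have \<alpha>0: "\<alpha> \<ge> 0" using \<alpha> by simp
  note R = rl_integral_right_has_deriv[OF \<alpha>0 D] vanishing_near_rl_integral_right[OF \<alpha>0 D(2)]
    vanishing_near_rl_integral_right[OF \<alpha>0 D(3)]
  have pow: "set_integrable lebesgue {a<..<b} (\<lambda>t. (t - a) powr (\<gamma> - 1))"
    using \<alpha> \<gamma> by (intro kernel_right(1)) auto
  have i: "set_integrable lebesgue {a<..<b} (\<lambda>t. x t * \<psi> t)"
    "set_integrable lebesgue {a<..<b} (\<lambda>t. x0 * ((t - a) powr (\<gamma> - 1) * \<psi> t))"
    "set_integrable lebesgue {a<..<b} (\<lambda>t. rl_integral a \<alpha> u t * \<psi> t)"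
    by (auto intro!: set_integrable_mult_vanishing_near[OF x D(2)] set_integrable_mult_vanishing_near[OF pow D(2)]
        rl_integral_duality(1)[OF \<alpha>0 u D(2)])
  have e: "(x t - x0 * (t - a) powr (\<gamma> - 1) - rl_integral a \<alpha> u t) * \<psi> t
      = x t * \<psi> t - x0 * ((t - a) powr (\<gamma> - 1) * \<psi> t) - rl_integral a \<alpha> u t * \<psi> t" for t
    by (simp add: algebra_simps)
  show "set_integrable lebesgue {a<..<b} (\<lambda>t. (x t - x0 * (t - a) powr (\<gamma> - 1) - rl_integral a \<alpha> u t) * \<psi> t)"
    unfolding e by (intro set_integral_diff i)
  \<comment> \<open>By \<open>R\<close> it is again C1 with derivative
    \<open>rl_integral_right b \<alpha> D\<close>, and it vanishes near b; it need not vanish at a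
    even if \<psi> does.\<close>
  have "test_function b (rl_integral_right b \<alpha> \<psi>)" by (rule test_functionI[OF R])
  then have "hilfer_deriv a b \<alpha> \<beta> x (rl_integral_right b \<alpha> \<psi>) = (LINT t:{a<..<b}|lebesgue. u t * rl_integral_right b \<alpha> \<psi> t)"
    using xu by (simp add: has_hilfer_deriv_def)
  also have "\<dots> = (LINT t:{a<..<b}|lebesgue. rl_integral a \<alpha> u t * \<psi> t)"
    by (rule rl_integral_duality(2)[OF \<alpha>0 u D(2), symmetric])
  also have "hilfer_deriv a b \<alpha> \<beta> x (rl_integral_right b \<alpha> \<psi>) =
      x0 * Gamma \<gamma> * rl_integral_right b (1 + \<beta> * (1 - \<alpha>)) (rl_integral_right b \<alpha> D) a
      - (LINT t:{a<..<b}|lebesgue. x t * rl_integral_right b (1 - \<alpha>) (rl_integral_right b \<alpha> D) t)"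
    using hilfer_deriv_test_function[OF _ _ _ _ x c R] \<alpha> by simp
  also have "(LINT t:{a<..<b}|lebesgue. x t * rl_integral_right b (1 - \<alpha>) (rl_integral_right b \<alpha> D) t)
      = (LINT t:{a<..<b}|lebesgue. - (x t * \<psi> t))"
    using rl_integral_right_add[OF _ \<alpha>0 D(3), of "1 - \<alpha>"] rl_integral_right_1_deriv[OF D] \<alpha>
    by (intro set_lebesgue_integral_cong) auto
  also have "\<dots> = - (LINT t:{a<..<b}|lebesgue. x t * \<psi> t)" by (simp add: set_lebesgue_integral_def)
  also have "rl_integral_right b (1 + \<beta> * (1 - \<alpha>)) (rl_integral_right b \<alpha> D) a = rl_integral_right b (1 + \<gamma>) D a"
  proof -
    have "1 + \<beta> * (1 - \<alpha>) + \<alpha> = 1 + \<gamma>" by (simp add: \<gamma>_def)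
    moreover have "1 + \<beta> * (1 - \<alpha>) \<ge> 0" using \<alpha> by simp
    ultimately show ?thesis using rl_integral_right_add[OF _ \<alpha>0 D(3) \<open>a < b\<close>] by metis
  qed
  \<comment> \<open>Splitting off order 1 brings back \<psi>, and order \<gamma> at a is the tested
    power function.\<close>
  also have "\<dots> = rl_integral_right b 1 (rl_integral_right b \<gamma> D) a"
    using rl_integral_right_add[OF _ _ D(3) \<open>a < b\<close>, of 1 \<gamma>] \<gamma> by simp
  also have "\<dots> = - rl_integral_right b \<gamma> \<psi> a"
    using rl_integral_right_has_deriv[OF _ D] vanishing_near_rl_integral_right D(2,3) \<open>a < b\<close> \<gamma>
    by (intro rl_integral_right_1_deriv) auto
  finally have "(LINT t:{a<..<b}|lebesgue. x t * \<psi> t) - x0 * (LINT t:{a<..<b}|lebesgue. (t - a) powr (\<gamma> - 1) * \<psi> t)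
     - (LINT t:{a<..<b}|lebesgue. rl_integral a \<alpha> u t * \<psi> t) = 0"
    by (simp add: integral_power_eq_rl_integral_right[OF \<gamma>])
  then show "(LINT t:{a<..<b}|lebesgue. (x t - x0 * (t - a) powr (\<gamma> - 1) - rl_integral a \<alpha> u t) * \<psi> t) = 0"
    unfolding e using i by (simp add: set_integral_diff)
qed

section \<open>From tested identities and weighted limits to pointwise statements\<close>

lemma DERIV_max_0_power2: "((\<lambda>x. (max 0 x)\<^sup>2) has_real_derivative 2 * max 0 x) (at (x::real))"
proof -
  consider "x > 0" | "x < 0" | "x = 0" by linarith
  then show ?thesis
  proof cases
    case 1
    then have "\<forall>\<^sub>F y in nhds x. (max 0 y)\<^sup>2 = y\<^sup>2"
      using eventually_nhds_in_open[of "{0<..}" x] by (auto elim!: eventually_mono)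
    moreover have "((\<lambda>x. x\<^sup>2) has_real_derivative 2 * x) (at x)" by (auto intro!: derivative_eq_intros)
    ultimately show ?thesis using 1 by (subst DERIV_cong_ev[OF refl _ refl]) (auto simp: max_def)
  next
    case 2
    then have "\<forall>\<^sub>F y in nhds x. (max 0 y)\<^sup>2 = 0"
      using eventually_nhds_in_open[of "{..<0}" x] by (auto elim!: eventually_mono)
    then show ?thesis using 2 by (subst DERIV_cong_ev[OF refl _ refl, of _ "\<lambda>_. 0"]) auto
  next
    case 3
    have "(\<lambda>h. max 0 h) \<midarrow>0\<rightarrow> max 0 (0::real)" by (intro tendsto_intros)
    moreover have "\<forall>\<^sub>F h in at (0::real). max 0 h = ((max 0 (0 + h))\<^sup>2 - (max 0 0)\<^sup>2) / h"
      by (auto simp: eventually_at_filter power2_eq_square max_def)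
    ultimately have "(\<lambda>h::real. ((max 0 (0 + h))\<^sup>2 - (max 0 0)\<^sup>2) / h) \<midarrow>0\<rightarrow> max 0 0"
      by (rule Lim_transform_eventually)
    then show ?thesis using 3 by (simp add: DERIV_def)
  qed
qed

text \<open>The fundamental lemma of the calculus of variations: a bump supported where w keeps the
  sign of \<open>w t\<close> would have a nonzero integral against w.\<close>

lemma continuous_eq_0_of_tested:
  fixes w :: "real \<Rightarrow> real"
  assumes w: "continuous_on {a<..<b} w"
    and i: "\<And>\<psi>. test_function b \<psi> \<Longrightarrow> set_integrable lebesgue {a<..<b} (\<lambda>t. w t * \<psi> t)"
    and 0: "\<And>\<psi>. test_function b \<psi> \<Longrightarrow> (LINT t:{a<..<b}|lebesgue. w t * \<psi> t) = 0"
    and t: "t \<in> {a<..<b}"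
  shows "w t = 0"
proof (rule ccontr)
  assume nz: "w t \<noteq> 0"
  have "isCont w t" using w t by (simp add: continuous_on_eq_continuous_at)
  then have "\<forall>\<^sub>F s in nhds t. w s * w t > 0"
    using nz by (intro order_tendstoD(1)[of _ "w t * w t"] tendsto_intros)
      (auto simp: isCont_def tendsto_nhds_iff zero_less_mult_iff)
  then have "\<forall>\<^sub>F s in nhds t. w s * w t > 0 \<and> s \<in> {a<..<b}"
    using eventually_nhds_in_open[of "{a<..<b}" t] t by (simp add: eventually_conj)
  then obtain e where e: "e > 0" "\<And>s. dist s t < e \<Longrightarrow> w s * w t > 0 \<and> s \<in> {a<..<b}"
    unfolding eventually_nhds_metric by blast
  \<comment> \<open>Halving makes the sign condition hold on the closed interval of radius d, which
    also keeps \<open>t + d\<close> below b.\<close>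
  define d where "d = e / 2"
  have d: "d > 0" and de: "\<And>s. \<bar>s - t\<bar> \<le> d \<Longrightarrow> w s * w t > 0 \<and> s \<in> {a<..<b}"
    using e by (auto simp: d_def dist_real_def)
  \<comment> \<open>A squared positive part is C1, which is all that \<open>test_function\<close>
    asks of a bump.\<close>
  define \<psi> where "\<psi> = (\<lambda>s. (max 0 (d\<^sup>2 - (s - t)\<^sup>2))\<^sup>2)"
  define D where "D = (\<lambda>s. 2 * max 0 (d\<^sup>2 - (s - t)\<^sup>2) * - (2 * (s - t)))"
  have out: "max 0 (d\<^sup>2 - (s - t)\<^sup>2) = 0" if "\<bar>s - t\<bar> \<ge> d" for s
    using power_mono[OF that, of 2] d by simp
  have in_b: "t + d < b" using de[of "t + d"] d by simp
  have "vanishing_near b \<psi>" "vanishing_near b D"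
    using out in_b unfolding vanishing_near_def \<psi>_def D_def
    by (auto intro!: continuous_intros exI[of _ "t + d"])
  moreover have "(\<psi> has_real_derivative D s) (at s)" for s
    unfolding \<psi>_def D_def
    by (rule DERIV_chain2[OF DERIV_max_0_power2]) (auto intro!: derivative_eq_intros)
  ultimately have \<psi>: "test_function b \<psi>" by (intro test_functionI)
  have pos: "\<psi> s > 0" if "\<bar>s - t\<bar> < d" for s
    using power_strict_mono[OF that, of 2] by (simp add: \<psi>_def)
  \<comment> \<open>The constant factor \<open>w t\<close> makes the integrand nonnegative for
    either sign of w.\<close>
  define g where "g = (\<lambda>s. indicat_real {a<..<b} s * (w s * \<psi> s) * w t)"
  have gi: "integrable lebesgue g" using i[OF \<psi>] by (simp add: g_def set_integrable_def)
  have g0: "(LINT s|lebesgue. g s) = 0" using 0[OF \<psi>] by (simp add: g_def set_lebesgue_integral_def)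
  have gnn: "g s \<ge> 0" for s
  proof (cases "\<bar>s - t\<bar> < d")
    case True
    then show ?thesis using de[of s] pos[OF True] by (simp add: g_def mult.commute mult.left_commute)
  next
    case False
    then show ?thesis using out[of s] by (simp add: g_def \<psi>_def)
  qed
  have gp: "g s > 0" if "\<bar>s - t\<bar> < d" for s
    using de[of s] pos[OF that] that by (simp add: g_def mult.commute mult.left_commute)
  have "AE s in lebesgue. g s = 0"
    using integral_nonneg_eq_0_iff_AE[OF gi] gnn g0 by simp
  then have "AE s in lebesgue. s \<notin> {t - d<..<t + d}"
    by (rule AE_mp) (use gp in \<open>auto intro!: AE_I2 simp: abs_less_iff\<close>, smt (verit))
  then have "{t - d<..<t + d} \<in> null_sets lebesgue"
    by (subst AE_iff_null_sets) auto
  then show False using d by (auto simp: null_sets_def)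
qed

text \<open>The integral of order 1 - \<gamma> of \<open>x0 * (s - a) powr (\<gamma> - 1)\<close> is
  the constant \<open>x0 * Gamma \<gamma>\<close>, since the exponents in \<open>Beta_kernel\<close>
  cancel. Near a the remainder v is at most e times that power, so it contributes at most
  \<open>e * Gamma \<gamma>\<close>. For \<gamma> = 1 the integral is the identity.\<close>

lemma rl_integral_limit:
  assumes \<gamma>: "0 < \<gamma>" "\<gamma> \<le> 1" and "a < b"
    and x: "set_integrable lebesgue {a<..<b} x"
    and lim: "((\<lambda>t. (t - a) powr (1 - \<gamma>) * x t) \<longlongrightarrow> x0) (at_right a)"
  shows "(rl_integral a (1 - \<gamma>) x \<longlongrightarrow> x0 * Gamma \<gamma>) (at_right a)"
proof (cases "\<gamma> = 1")
  case True
  have "\<forall>\<^sub>F t in at_right a. (t - a) powr (1 - \<gamma>) * x t = rl_integral a (1 - \<gamma>) x t"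
    using True by (auto simp: eventually_at_right_field rl_integral_def intro!: exI[of _ b] \<open>a < b\<close>)
  then show ?thesis using lim True by (simp add: tendsto_cong)
next
  case False
  with \<gamma> have \<gamma>1: "\<gamma> < 1" by simp
  have G: "Gamma \<gamma> > 0" "Gamma (1 - \<gamma>) > 0" using \<gamma> \<gamma>1 by auto
  have Beta: "Beta (1 - \<gamma>) \<gamma> = Gamma (1 - \<gamma>) * Gamma \<gamma>" by (simp add: Beta_def)
  define v where "v = (\<lambda>s. x s - x0 * (s - a) powr (\<gamma> - 1))"
  have bound: "\<forall>\<^sub>F t in at_right a. \<bar>rl_integral a (1 - \<gamma>) x t - x0 * Gamma \<gamma>\<bar> \<le> e * Gamma \<gamma>" if "e > 0" for e
  proof -
    have "\<forall>\<^sub>F s in at_right a. \<bar>(s - a) powr (1 - \<gamma>) * x s - x0\<bar> < e"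
      using tendstoD[OF lim \<open>e > 0\<close>] by (simp add: dist_real_def)
    then obtain d where d: "d > a" "\<And>s. a < s \<Longrightarrow> s < d \<Longrightarrow> \<bar>(s - a) powr (1 - \<gamma>) * x s - x0\<bar> < e"
      by (auto simp: eventually_at_right_field)
    have v: "\<bar>v s\<bar> \<le> e * (s - a) powr (\<gamma> - 1)" if "a < s" "s < d" for s
    proof -
      have "(s - a) powr (\<gamma> - 1) * (s - a) powr (1 - \<gamma>) = 1"
        using that by (simp add: powr_add[symmetric])
      then have "v s = (s - a) powr (\<gamma> - 1) * ((s - a) powr (1 - \<gamma>) * x s - x0)"
        by (simp add: v_def algebra_simps)
      then show ?thesis using mult_left_mono[OF less_imp_le[OF d(2)[OF that]], of "(s - a) powr (\<gamma> - 1)"]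
        by (simp add: abs_mult mult.commute)
    qed
    show ?thesis unfolding eventually_at_right_field
    proof (intro exI[of _ "min b d"] conjI allI impI)
      show "a < min b d" using d \<open>a < b\<close> by simp
      fix t assume t: "a < t" "t < min b d"
      have "set_borel_measurable lebesgue {a<..<t} v"
      proof -
        have "set_integrable lebesgue {a<..<t} x" by (rule set_integrable_subset[OF x]) (use t in auto)
        moreover have "set_integrable lebesgue {a<..<t} (\<lambda>s. (s - a) powr (\<gamma> - 1))"
          using kernel_right(1)[of \<gamma> a t] \<gamma> t by simp
        ultimately have "set_integrable lebesgue {a<..<t} v" unfolding v_def by (intro set_integral_diff set_integrable_mult_right) auto
        then show ?thesis by (auto simp: set_integrable_def set_borel_measurable_def)
      qed
      note B = rl_kernel_bound[of "1 - \<gamma>" \<gamma> a t v e, OF _ _ t(1) this v]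
      note K = Beta_kernel[of "1 - \<gamma>" \<gamma> a t, OF _ _ t(1)]
      have "(LINT s:{a<..<t}|lebesgue. (t - s) powr (1 - \<gamma> - 1) * x s)
          = (LINT s:{a<..<t}|lebesgue. (t - s) powr (1 - \<gamma> - 1) * v s + x0 * ((t - s) powr (1 - \<gamma> - 1) * (s - a) powr (\<gamma> - 1)))"
        by (intro set_lebesgue_integral_cong) (auto simp: v_def algebra_simps)
      also have "\<dots> = (LINT s:{a<..<t}|lebesgue. (t - s) powr (1 - \<gamma> - 1) * v s) + x0 * (Gamma (1 - \<gamma>) * Gamma \<gamma>)"
        using B(1) K \<gamma> \<gamma>1 t Beta by (subst set_integral_add(2)) auto
      finally have eq: "rl_integral a (1 - \<gamma>) x t - x0 * Gamma \<gamma>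
          = 1 / Gamma (1 - \<gamma>) * (LINT s:{a<..<t}|lebesgue. (t - s) powr (1 - \<gamma> - 1) * v s)"
        using \<gamma>1 G(2) less_imp_neq[OF G(2)] by (simp add: rl_integral_def field_simps)
      have "\<bar>LINT s:{a<..<t}|lebesgue. (t - s) powr (1 - \<gamma> - 1) * v s\<bar> \<le> e * (Gamma (1 - \<gamma>) * Gamma \<gamma>)"
        using B(2) \<gamma> \<gamma>1 t Beta by simp
      then show "\<bar>rl_integral a (1 - \<gamma>) x t - x0 * Gamma \<gamma>\<bar> \<le> e * Gamma \<gamma>"
        unfolding eq using G by (simp add: abs_mult pos_divide_le_eq mult_ac)
    qed
  qed
  show ?thesis
  proof (rule tendstoI)
    fix e :: real assume "e > 0"
    then have "\<forall>\<^sub>F t in at_right a. \<bar>rl_integral a (1 - \<gamma>) x t - x0 * Gamma \<gamma>\<bar> \<le> e / (2 * Gamma \<gamma>) * Gamma \<gamma>"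
      using G by (intro bound) simp
    then show "\<forall>\<^sub>F t in at_right a. dist (rl_integral a (1 - \<gamma>) x t) (x0 * Gamma \<gamma>) < e"
      by eventually_elim (use G \<open>e > 0\<close> in \<open>auto simp: dist_real_def\<close>)
  qed
qed

subsection \<open>Picard iteration\<close>

text \<open>
  The Caratheodory property; \<open>y\<close> is approximated by functions with countably many values, truncated
  so that they stay in the interval.
\<close>

lemma Caratheodory_measurable:
  fixes g :: "real \<Rightarrow> real \<Rightarrow> real" and y :: "real \<Rightarrow> real"
  assumes cont: "\<And>s. s \<in> space N \<Longrightarrow> continuous_on {c..d} (g s)"
    and meas: "\<And>v. v \<in> {c..d} \<Longrightarrow> (\<lambda>s. g s v) \<in> borel_measurable N"
    and y[measurable]: "y \<in> borel_measurable N" and yE: "\<And>s. s \<in> space N \<Longrightarrow> y s \<in> {c..d}"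
    and "c \<le> d"
  shows "(\<lambda>s. g s (y s)) \<in> borel_measurable N"
proof (rule borel_measurable_LIMSEQ_real)
  \<comment> \<open>Rounding down to multiples of \<open>1 / Suc n\<close> cannot exceed d, so only
    the lower end needs truncation.\<close>
  define q where "q = (\<lambda>n v. max c (real_of_int \<lfloor>real (Suc n) * v\<rfloor> / real (Suc n)))"
  have q_mem: "q n v \<in> {c..d}" if "v \<in> {c..d}" for n v
  proof -
    have "real_of_int \<lfloor>real (Suc n) * v\<rfloor> / real (Suc n) \<le> v"
      by (simp add: divide_le_eq mult.commute del: of_nat_Suc)
    then show ?thesis using that by (auto simp: q_def)
  qed
  show "(\<lambda>n. g s (q n (y s))) \<longlonglongrightarrow> g s (y s)" if s: "s \<in> space N" for s
  proof (rule continuous_on_tendsto_compose[OF cont[OF s]])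
    show "(\<lambda>n. q n (y s)) \<longlonglongrightarrow> y s"
    proof (rule real_tendsto_sandwich[where f = "\<lambda>n. y s - 1 / real (Suc n)" and h = "\<lambda>_. y s"])
      show "\<forall>\<^sub>F n in sequentially. y s - 1 / real (Suc n) \<le> q n (y s)"
      proof (intro always_eventually allI)
        fix n
        have "real (Suc n) * y s - 1 \<le> real_of_int \<lfloor>real (Suc n) * y s\<rfloor>" by linarith
        then have "(real (Suc n) * y s - 1) / real (Suc n) \<le> real_of_int \<lfloor>real (Suc n) * y s\<rfloor> / real (Suc n)"
          by (intro divide_right_mono) auto
        then show "y s - 1 / real (Suc n) \<le> q n (y s)"
          by (simp add: q_def diff_divide_distrib del: of_nat_Suc)
      qed
      show "\<forall>\<^sub>F n in sequentially. q n (y s) \<le> y s"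
        using yE[OF s] by (intro always_eventually allI) (simp add: q_def divide_le_eq mult.commute del: of_nat_Suc)
      have "(\<lambda>n. y s - 1 / real (Suc n)) \<longlonglongrightarrow> y s - 0"
        by (intro tendsto_intros LIMSEQ_Suc[OF lim_1_over_n])
      then show "(\<lambda>n. y s - 1 / real (Suc n)) \<longlonglongrightarrow> y s" by simp
    qed simp
  qed (use q_mem yE s in auto)
  show "(\<lambda>s. g s (q n (y s))) \<in> borel_measurable N" for n
  proof -
    \<comment> \<open>Here i ranges over all integers, including values that are never attained, so
      both ends are clamped.\<close>
    define r where "r = (\<lambda>i::int. min d (max c (real_of_int i / real (Suc n))))"
    have "(\<lambda>s. g s (r \<lfloor>real (Suc n) * y s\<rfloor>)) \<in> borel_measurable N"
    proof (rule measurable_compose_countable)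
      show "(\<lambda>s. g s (r i)) \<in> borel_measurable N" for i
        using \<open>c \<le> d\<close> by (intro meas) (auto simp: r_def)
    qed measurable
    moreover have "r \<lfloor>real (Suc n) * y s\<rfloor> = q n (y s)" if "s \<in> space N" for s
      using q_mem[OF yE[OF that], of n] unfolding r_def q_def by (intro min_absorb2) auto
    ultimately show ?thesis by (simp cong: measurable_cong)
  qed
qed

text \<open>The assumption \<open>small\<close> is the self-map condition that the formula for l is
  designed to give; A is a fixed Lipschitz constant.\<close>

locale hilfer_ivp =
  fixes \<alpha> \<beta> a x0 b k M A l :: real and f :: "real \<Rightarrow> real \<Rightarrow> real"
  assumes \<alpha>: "0 < \<alpha>" "\<alpha> < 1" and \<beta>: "0 \<le> \<beta>" "\<beta> \<le> 1"
    and pos: "b > 0" "M \<ge> 0" "A > 0" "l > 0" and k: "k > \<beta> * (1 - \<alpha>) - 1"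
    and small: "M * Beta \<alpha> (k + 1) / Gamma \<alpha> * l powr (1 - \<beta> * (1 - \<alpha>) + k) \<le> b"
    and meas: "\<And>v. v \<in> {x0 - b..x0 + b} \<Longrightarrow>
      (\<lambda>s. f s ((s - a) powr (\<alpha> + \<beta> * (1 - \<alpha>) - 1) * v)) \<in> borel_measurable (lebesgue_on {a<..a + l})"
    and bnd: "\<And>s v. s \<in> {a<..a + l} \<Longrightarrow> v \<in> {x0 - b..x0 + b} \<Longrightarrow>
      \<bar>f s ((s - a) powr (\<alpha> + \<beta> * (1 - \<alpha>) - 1) * v)\<bar> \<le> M * (s - a) powr k"
    and lips: "\<And>s v w. s \<in> {a<..a + l} \<Longrightarrow> v \<in> {x0 - b..x0 + b} \<Longrightarrow> w \<in> {x0 - b..x0 + b} \<Longrightarrow>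
      \<bar>f s ((s - a) powr (\<alpha> + \<beta> * (1 - \<alpha>) - 1) * v) - f s ((s - a) powr (\<alpha> + \<beta> * (1 - \<alpha>) - 1) * w)\<bar>
        \<le> A * (s - a) powr k * \<bar>v - w\<bar>"
begin

section \<open>The rescaled problem and estimates for its Picard operator\<close>

definition \<gamma> where "\<gamma> = \<alpha> + \<beta> * (1 - \<alpha>)"
text \<open>This is \<mu> + k, the power of \<open>t - a\<close> gained by one application of P, as
  the last part of \<open>exponents\<close> shows.\<close>

definition \<sigma> where "\<sigma> = 1 - \<beta> * (1 - \<alpha>) + k"
definition g where "g = (\<lambda>s v. f s ((s - a) powr (\<gamma> - 1) * v))"

text \<open>Measurability, unlike continuity, survives pointwise limits; for fixed points continuity
  is recovered from \<open>continuous_P\<close>.\<close>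

definition admissible where
  "admissible y \<longleftrightarrow> y \<in> borel_measurable (lebesgue_on {a<..a + l}) \<and>
     (\<forall>t\<in>{a<..a + l}. y t \<in> {x0 - b..x0 + b})"

text \<open>The Picard operator for \<open>y t = (t - a) powr (1 - \<gamma>) * x t\<close>.\<close>

definition P where
  "P y t = x0 + (t - a) powr (1 - \<gamma>) / Gamma \<alpha> *
     (LINT s:{a<..<t}|lebesgue. (t - s) powr (\<alpha> - 1) * g s (y s))"

lemma exponents:
  shows "0 < \<gamma>" "\<gamma> \<le> 1" "\<sigma> > 0" "k + 1 > 0" "(1 - \<beta>) * (1 - \<alpha>) = 1 - \<gamma>" "1 - \<gamma> + (\<alpha> + k) = \<sigma>"
proof -
  have "\<beta> * (1 - \<alpha>) \<ge> 0" "(1 - \<beta>) * (1 - \<alpha>) \<ge> 0" using \<alpha> \<beta> by auto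
  then show "0 < \<gamma>" "\<gamma> \<le> 1" "\<sigma> > 0" "k + 1 > 0" "(1 - \<beta>) * (1 - \<alpha>) = 1 - \<gamma>" "1 - \<gamma> + (\<alpha> + k) = \<sigma>"
    using \<alpha> k by (auto simp: \<gamma>_def \<sigma>_def algebra_simps)
qed

lemma Gamma_\<alpha>: "Gamma \<alpha> > 0"
  using \<alpha> by auto

lemma powr_cancel: "t > a \<Longrightarrow> (t - a) powr (\<gamma> - 1) * ((t - a) powr (1 - \<gamma>) * z) = z"
  and powr_cancel': "t > a \<Longrightarrow> (t - a) powr (1 - \<gamma>) * ((t - a) powr (\<gamma> - 1) * z) = z"
  by (simp_all add: mult.assoc[symmetric] powr_add[symmetric])

text \<open>The exponent is left as \<open>k + 1 - 1\<close> to match the pattern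
  \<open>q - 1\<close> of the kernel lemmas.\<close>

lemma g_bound: "s \<in> {a<..a + l} \<Longrightarrow> v \<in> {x0 - b..x0 + b} \<Longrightarrow> \<bar>g s v\<bar> \<le> M * (s - a) powr (k + 1 - 1)"
  using bnd by (simp add: g_def \<gamma>_def)

lemma g_continuous:
  assumes "s \<in> {a<..a + l}"
  shows "continuous_on {x0 - b..x0 + b} (g s)"
proof -
  have "(A * (s - a) powr k)-lipschitz_on {x0 - b..x0 + b} (g s)"
    using lips[OF assms] pos by (intro lipschitz_onI) (auto simp: dist_real_def g_def \<gamma>_def)
  then show ?thesis by (rule lipschitz_on_continuous_on)
qed

lemma g_measurable:
  assumes "admissible y"
  shows "set_borel_measurable lebesgue {a<..a + l} (\<lambda>s. g s (y s))"
proof -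
  have "(\<lambda>s. g s (y s)) \<in> borel_measurable (lebesgue_on {a<..a + l})"
  proof (rule Caratheodory_measurable[where g = g and c = "x0 - b" and d = "x0 + b"])
    show "(\<lambda>s. g s v) \<in> borel_measurable (lebesgue_on {a<..a + l})" if "v \<in> {x0 - b..x0 + b}" for v
      using meas[OF that] by (simp add: g_def \<gamma>_def)
  qed (use assms g_continuous pos in \<open>auto simp: admissible_def\<close>)
  then show ?thesis
    by (simp add: set_borel_measurable_def borel_measurable_restrict_space_iff)
qed

lemma kernel:
  assumes "admissible y" "t \<in> {a<..a + l}"
  shows "set_integrable lebesgue {a<..<t} (\<lambda>s. (t - s) powr (\<alpha> - 1) * g s (y s))"
    and "\<bar>P y t - x0\<bar> \<le> M * Beta \<alpha> (k + 1) / Gamma \<alpha> * (t - a) powr \<sigma>"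
proof -
  have m: "set_borel_measurable lebesgue {a<..<t} (\<lambda>s. g s (y s))"
    by (rule set_borel_measurable_subset[OF g_measurable[OF assms(1)]]) (use assms(2) in auto)
  have M: "\<bar>g s (y s)\<bar> \<le> M * (s - a) powr (k + 1 - 1)" if "s \<in> {a<..<t}" for s
    using that assms by (intro g_bound) (auto simp: admissible_def)
  show "set_integrable lebesgue {a<..<t} (\<lambda>s. (t - s) powr (\<alpha> - 1) * g s (y s))"
    by (rule rl_kernel_bound(1)[OF _ _ _ m M]) (use \<alpha> exponents assms(2) in auto)
  have "\<bar>LINT s:{a<..<t}|lebesgue. (t - s) powr (\<alpha> - 1) * g s (y s)\<bar> \<le> M * (Beta \<alpha> (k + 1) * (t - a) powr (\<alpha> + (k + 1) - 1))"
    by (rule rl_kernel_bound(2)[OF _ _ _ m M]) (use \<alpha> exponents assms(2) in auto)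
  then have "(t - a) powr (1 - \<gamma>) / Gamma \<alpha> * \<bar>LINT s:{a<..<t}|lebesgue. (t - s) powr (\<alpha> - 1) * g s (y s)\<bar>
      \<le> (t - a) powr (1 - \<gamma>) / Gamma \<alpha> * (M * (Beta \<alpha> (k + 1) * (t - a) powr (\<alpha> + (k + 1) - 1)))"
    using Gamma_\<alpha> by (intro mult_left_mono) auto
  also have "\<dots> = M * Beta \<alpha> (k + 1) / Gamma \<alpha> * ((t - a) powr (1 - \<gamma>) * (t - a) powr (\<alpha> + k))"
    by (simp add: mult_ac)
  also have "(t - a) powr (1 - \<gamma>) * (t - a) powr (\<alpha> + k) = (t - a) powr \<sigma>"
    by (simp add: powr_add[symmetric] exponents(6))
  finally show "\<bar>P y t - x0\<bar> \<le> M * Beta \<alpha> (k + 1) / Gamma \<alpha> * (t - a) powr \<sigma>"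
    using Gamma_\<alpha> by (simp add: P_def abs_mult)
qed

lemma continuous_rl_g:
  assumes "admissible y"
  shows "continuous_on {a<..a + l} (\<lambda>t. LINT s:{a<..<t}|lebesgue. (t - s) powr (\<alpha> - 1) * g s (y s))"
proof (rule continuous_on_rl_kernel)
  show "set_borel_measurable lebesgue {a<..<a + l} (\<lambda>s. g s (y s))"
    by (rule set_borel_measurable_subset[OF g_measurable[OF assms]]) auto
  show "\<bar>g s (y s)\<bar> \<le> M * (s - a) powr (k + 1 - 1)" if "s \<in> {a<..<a + l}" for s
    using that assms by (intro g_bound) (auto simp: admissible_def)
qed (use \<alpha> exponents in auto)

lemma continuous_P: "admissible y \<Longrightarrow> continuous_on {a<..a + l} (P y)"
  unfolding P_def using Gamma_\<alpha> by (intro continuous_intros continuous_rl_g) auto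

lemma continuous_measurable:
  "continuous_on {a<..a + l} y \<Longrightarrow> y \<in> borel_measurable (lebesgue_on {a<..a + l})"
  by (rule continuous_imp_measurable_on_sets_lebesgue) auto

text \<open>As \<sigma> > 0, the bound on \<open>P y t - x0\<close> is largest at t = a + l, where
  \<open>small\<close> applies.\<close>

lemma admissible_P:
  assumes "admissible y"
  shows "admissible (P y)"
  unfolding admissible_def
proof (intro conjI ballI continuous_measurable continuous_P assms)
  fix t assume t: "t \<in> {a<..a + l}"
  have "M * Beta \<alpha> (k + 1) / Gamma \<alpha> * (t - a) powr \<sigma> \<le> M * Beta \<alpha> (k + 1) / Gamma \<alpha> * l powr \<sigma>"
    using t pos Gamma_\<alpha> Beta_real_pos[of \<alpha> "k + 1"] \<alpha> exponents
    by (intro mult_left_mono powr_mono2) auto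
  also have "\<dots> \<le> b" using small by (simp add: \<sigma>_def)
  finally have "\<bar>P y t - x0\<bar> \<le> b" using kernel(2)[OF assms t] by linarith
  then show "P y t \<in> {x0 - b..x0 + b}" by (simp add: abs_le_iff)
qed

text \<open>The Lipschitz bound gives \<open>g s (y s) - g s (z s)\<close> the exponent k + p, so
  the Beta kernel applies with q = k + 1 + p. What is gained is a higher order of vanishing at a,
  not a small constant.\<close>

lemma P_contraction:
  assumes y: "admissible y" and z: "admissible z"
    and C: "\<And>s. s \<in> {a<..a + l} \<Longrightarrow> \<bar>y s - z s\<bar> \<le> C * (s - a) powr p" and p: "p \<ge> 0"
    and t: "t \<in> {a<..a + l}"
  shows "\<bar>P y t - P z t\<bar> \<le> C * (A / Gamma \<alpha> * Beta \<alpha> (k + 1 + p)) * (t - a) powr (p + \<sigma>)"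
proof -
  have sub: "set_borel_measurable lebesgue {a<..<t} (\<lambda>s. g s (w s))" if "admissible w" for w
    by (rule set_borel_measurable_subset[OF g_measurable[OF that]]) (use t in auto)
  have m: "set_borel_measurable lebesgue {a<..<t} (\<lambda>s. g s (y s) - g s (z s))"
    using sub[OF y] sub[OF z] by (simp add: set_borel_measurable_def right_diff_distrib)
  have b: "\<bar>g s (y s) - g s (z s)\<bar> \<le> A * C * (s - a) powr (k + 1 + p - 1)" if "s \<in> {a<..<t}" for s
  proof -
    have s: "s \<in> {a<..a + l}" using that t by auto
    have "\<bar>g s (y s) - g s (z s)\<bar> \<le> A * (s - a) powr k * \<bar>y s - z s\<bar>"
      using lips[OF s] y z s by (simp add: g_def \<gamma>_def admissible_def)
    also have "\<dots> \<le> A * (s - a) powr k * (C * (s - a) powr p)"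
      using C[OF s] pos by (intro mult_left_mono) auto
    also have "\<dots> = A * C * (s - a) powr (k + 1 + p - 1)" by (simp add: powr_add)
    finally show ?thesis .
  qed
  have "\<bar>LINT s:{a<..<t}|lebesgue. (t - s) powr (\<alpha> - 1) * (g s (y s) - g s (z s))\<bar>
      \<le> A * C * (Beta \<alpha> (k + 1 + p) * (t - a) powr (\<alpha> + (k + 1 + p) - 1))"
    by (rule rl_kernel_bound(2)[OF _ _ _ m b]) (use \<alpha> exponents p t in auto)
  also have "(LINT s:{a<..<t}|lebesgue. (t - s) powr (\<alpha> - 1) * (g s (y s) - g s (z s)))
      = (LINT s:{a<..<t}|lebesgue. (t - s) powr (\<alpha> - 1) * g s (y s)) - (LINT s:{a<..<t}|lebesgue. (t - s) powr (\<alpha> - 1) * g s (z s))"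
    using kernel(1)[OF y t] kernel(1)[OF z t] by (simp add: right_diff_distrib)
  finally have *: "(t - a) powr (1 - \<gamma>) / Gamma \<alpha> * \<bar>(LINT s:{a<..<t}|lebesgue. (t - s) powr (\<alpha> - 1) * g s (y s)) - (LINT s:{a<..<t}|lebesgue. (t - s) powr (\<alpha> - 1) * g s (z s))\<bar>
      \<le> (t - a) powr (1 - \<gamma>) / Gamma \<alpha> * (A * C * (Beta \<alpha> (k + 1 + p) * (t - a) powr (\<alpha> + (k + 1 + p) - 1)))"
    using Gamma_\<alpha> by (intro mult_left_mono) auto
  have "P y t - P z t = (t - a) powr (1 - \<gamma>) / Gamma \<alpha> * ((LINT s:{a<..<t}|lebesgue. (t - s) powr (\<alpha> - 1) * g s (y s)) - (LINT s:{a<..<t}|lebesgue. (t - s) powr (\<alpha> - 1) * g s (z s)))"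
    by (simp add: P_def right_diff_distrib)
  then have "\<bar>P y t - P z t\<bar> = (t - a) powr (1 - \<gamma>) / Gamma \<alpha> * \<bar>(LINT s:{a<..<t}|lebesgue. (t - s) powr (\<alpha> - 1) * g s (y s)) - (LINT s:{a<..<t}|lebesgue. (t - s) powr (\<alpha> - 1) * g s (z s))\<bar>"
    using Gamma_\<alpha> by (simp add: abs_mult)
  also note *
  also have "(t - a) powr (1 - \<gamma>) / Gamma \<alpha> * (A * C * (Beta \<alpha> (k + 1 + p) * (t - a) powr (\<alpha> + (k + 1 + p) - 1)))
      = C * (A / Gamma \<alpha> * Beta \<alpha> (k + 1 + p)) * ((t - a) powr (1 - \<gamma>) * (t - a) powr (\<alpha> + (k + 1 + p) - 1))"
    by (simp add: mult_ac)
  also have "(t - a) powr (1 - \<gamma>) * (t - a) powr (\<alpha> + (k + 1 + p) - 1) = (t - a) powr (p + \<sigma>)"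
  proof -
    have "1 - \<gamma> + (\<alpha> + (k + 1 + p) - 1) = p + \<sigma>" using exponents(6) by linarith
    then show ?thesis unfolding powr_add[symmetric] by (rule arg_cong)
  qed
  finally show ?thesis .
qed

text \<open>The factors are those of \<open>P_contraction\<close> for p = j\<sigma>; 2b is the
  length of the interval of values and bounds the initial difference.\<close>

definition C :: "nat \<Rightarrow> real" where
  "C n = 2 * b * (\<Prod>j<n. A / Gamma \<alpha> * Beta \<alpha> (k + 1 + real j * \<sigma>))"

lemma C_nonneg: "C n \<ge> 0"
  unfolding C_def using pos Gamma_\<alpha> \<alpha> exponents
  by (intro mult_nonneg_nonneg prod_nonneg ballI less_imp_le[OF Beta_real_pos]) (auto simp: add_pos_nonneg)

lemma admissible_funpow: "admissible y \<Longrightarrow> admissible ((P ^^ n) y)"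
  by (induction n) (auto intro: admissible_P)

lemma P_iterates:
  assumes "admissible y" "admissible z" "t \<in> {a<..a + l}"
  shows "\<bar>(P ^^ n) y t - (P ^^ n) z t\<bar> \<le> C n * (t - a) powr (real n * \<sigma>)"
  using assms(3)
proof (induction n arbitrary: t)
  case 0
  then have "y t \<in> {x0 - b..x0 + b}" "z t \<in> {x0 - b..x0 + b}" using assms by (auto simp: admissible_def)
  then show ?case using 0 by (simp add: C_def abs_le_iff)
next
  case (Suc n)
  have "\<bar>P ((P ^^ n) y) t - P ((P ^^ n) z) t\<bar>
      \<le> C n * (A / Gamma \<alpha> * Beta \<alpha> (k + 1 + real n * \<sigma>)) * (t - a) powr (real n * \<sigma> + \<sigma>)"
    using exponents by (intro P_contraction admissible_funpow assms Suc) auto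
  then show ?case by (simp add: C_def algebra_simps)
qed

text \<open>The ratio of consecutive terms is \<open>c n\<close>, which tends to 0 by
  \<open>Beta_arith_tendsto_0\<close> whatever the size of A and t.\<close>

lemma summable_bound:
  assumes "t > a"
  shows "summable (\<lambda>n. C n * (t - a) powr (real n * \<sigma>))"
proof -
  define c where "c = (\<lambda>n. A / Gamma \<alpha> * Beta \<alpha> (k + 1 + real n * \<sigma>) * (t - a) powr \<sigma>)"
  have "c \<longlonglongrightarrow> A / Gamma \<alpha> * 0 * (t - a) powr \<sigma>"
    unfolding c_def using exponents \<alpha> by (intro tendsto_intros Beta_arith_tendsto_0) auto
  then have "\<forall>\<^sub>F n in sequentially. c n < 1 / 2" by (intro order_tendstoD) auto
  then obtain N where N: "\<And>n. n \<ge> N \<Longrightarrow> c n \<le> 1 / 2" by (auto simp: eventually_sequentially intro: less_imp_le)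
  show ?thesis
  proof (rule summable_ratio_test[of "1 / 2" N])
    fix n assume "n \<ge> N"
    have "C (Suc n) * (t - a) powr (real (Suc n) * \<sigma>) = C n * (t - a) powr (real n * \<sigma>) * c n"
      by (simp add: C_def c_def distrib_right powr_add mult_ac)
    also have "\<dots> \<le> C n * (t - a) powr (real n * \<sigma>) * (1 / 2)"
      using N[OF \<open>n \<ge> N\<close>] C_nonneg by (intro mult_left_mono) auto
    finally show "norm (C (Suc n) * (t - a) powr (real (Suc n) * \<sigma>)) \<le> 1 / 2 * norm (C n * (t - a) powr (real n * \<sigma>))"
      using C_nonneg by (simp add: mult.commute)
  qed simp
qed

text \<open>Iterating P does not move y and z, while \<open>P_iterates\<close> bounds their distance
  by terms of a convergent series.\<close>

lemma fixed_point_unique: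
  assumes "admissible y" "admissible z" "t \<in> {a<..a + l}"
    and "\<And>t. t \<in> {a<..a + l} \<Longrightarrow> P y t = y t" "\<And>t. t \<in> {a<..a + l} \<Longrightarrow> P z t = z t"
  shows "y t = z t"
proof -
  \<comment> \<open>The fixed point equations hold on the interval only, so iterating them needs
    that P there ignores values outside.\<close>
  have P_cong: "P v t = P w t" if "\<And>s. s \<in> {a<..a + l} \<Longrightarrow> v s = w s" "t \<in> {a<..a + l}" for v w t
    unfolding P_def using that
    by (intro arg_cong2[of _ _ _ _ "(+)"] arg_cong2[of _ _ _ _ "(*)"] set_lebesgue_integral_cong) auto
  have fix_: "(P ^^ n) w t = w t"
    if "\<And>t. t \<in> {a<..a + l} \<Longrightarrow> P w t = w t" "t \<in> {a<..a + l}" for w n t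
    using that(2)
  proof (induction n arbitrary: t)
    case (Suc n)
    have "P ((P ^^ n) w) t = P w t" by (rule P_cong) (use Suc in auto)
    then show ?case using that(1) Suc.prems by simp
  qed simp
  have "\<bar>y t - z t\<bar> \<le> C n * (t - a) powr (real n * \<sigma>)" for n
    using P_iterates[OF assms(1-3), of n] fix_[of y t n] fix_[of z t n] assms by simp
  moreover have "(\<lambda>n. C n * (t - a) powr (real n * \<sigma>)) \<longlonglongrightarrow> 0"
    using assms(3) by (intro summable_LIMSEQ_zero summable_bound) auto
  ultimately have "\<bar>y t - z t\<bar> \<le> 0" by (intro LIMSEQ_le_const) auto
  then show ?thesis by simp
qed

section \<open>The limit of the iterates\<close>

definition Y where "Y t = lim (\<lambda>n. (P ^^ n) (\<lambda>_. x0) t)"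

lemma admissible_const: "admissible (\<lambda>_. x0)"
  using pos by (simp add: admissible_def)

text \<open>A telescoping series: the increment from n to n + 1 is the difference of the n-th
  iterates started at \<open>P (\<lambda>_. x0)\<close> and at the constant x0, so
  \<open>P_iterates\<close> bounds it.\<close>

lemma convergent_iterates:
  assumes "t \<in> {a<..a + l}"
  shows "convergent (\<lambda>n. (P ^^ n) (\<lambda>_. x0) t)"
proof -
  have "summable (\<lambda>n. (P ^^ Suc n) (\<lambda>_. x0) t - (P ^^ n) (\<lambda>_. x0) t)"
  proof (rule summable_comparison_test)
    have "\<bar>(P ^^ Suc n) (\<lambda>_. x0) t - (P ^^ n) (\<lambda>_. x0) t\<bar> \<le> C n * (t - a) powr (real n * \<sigma>)" for n
      using P_iterates[OF admissible_P[OF admissible_const] admissible_const assms, of n]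
      by (simp add: funpow_swap1)
    then show "\<exists>N. \<forall>n\<ge>N. norm ((P ^^ Suc n) (\<lambda>_. x0) t - (P ^^ n) (\<lambda>_. x0) t) \<le> C n * (t - a) powr (real n * \<sigma>)"
      by auto
  qed (use assms in \<open>auto intro: summable_bound\<close>)
  then have "convergent (\<lambda>n. \<Sum>i<n. (P ^^ Suc i) (\<lambda>_. x0) t - (P ^^ i) (\<lambda>_. x0) t)"
    by (simp only: summable_iff_convergent)
  moreover have "(\<Sum>i<n. (P ^^ Suc i) (\<lambda>_. x0) t - (P ^^ i) (\<lambda>_. x0) t) = (P ^^ n) (\<lambda>_. x0) t - x0" for n
    by (induction n) auto
  ultimately have "convergent (\<lambda>n. (P ^^ n) (\<lambda>_. x0) t - x0)" by (simp only:)
  then show ?thesis by (subst (asm) convergent_diff_const_right_iff)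
qed

lemma Y_limit: "t \<in> {a<..a + l} \<Longrightarrow> (\<lambda>n. (P ^^ n) (\<lambda>_. x0) t) \<longlonglongrightarrow> Y t"
  unfolding Y_def using convergent_iterates by (simp add: convergent_LIMSEQ_iff)

lemma admissible_Y: "admissible Y"
  unfolding admissible_def
proof (intro conjI ballI)
  show "Y \<in> borel_measurable (lebesgue_on {a<..a + l})"
    by (rule borel_measurable_LIMSEQ_real[OF Y_limit])
      (use admissible_funpow[OF admissible_const] in \<open>auto simp: admissible_def\<close>)
  fix t assume t: "t \<in> {a<..a + l}"
  show "Y t \<in> {x0 - b..x0 + b}"
    by (rule closed_sequentially[OF _ _ Y_limit[OF t]])
      (use admissible_funpow[OF admissible_const] t in \<open>auto simp: admissible_def\<close>)
qed

text \<open>Passing to the limit in P: the bound on g holds uniformly over admissible functions, so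
  one Beta kernel dominates all integrands, and continuity of \<open>g s\<close> gives their
  pointwise limits.\<close>

lemma P_Y:
  assumes t: "t \<in> {a<..a + l}"
  shows "P Y t = Y t"
proof -
  define y where "y = (\<lambda>n. (P ^^ n) (\<lambda>_. x0))"
  have y: "admissible (y n)" for n by (simp add: y_def admissible_funpow admissible_const)
  define J where "J = (\<lambda>w s. indicat_real {a<..<t} s * ((t - s) powr (\<alpha> - 1) * g s (w s)))"
  have Jm: "J w \<in> borel_measurable lebesgue" if "admissible w" for w
    using kernel(1)[OF that t] by (auto simp: J_def set_integrable_def)
  have "(\<lambda>n. LINT s|lebesgue. J (y n) s) \<longlonglongrightarrow> (LINT s|lebesgue. J Y s)"
  proof (rule integral_dominated_convergence[where w = "\<lambda>s. M * (indicat_real {a<..<t} s * ((t - s) powr (\<alpha> - 1) * (s - a) powr (k + 1 - 1)))"])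
    show "integrable lebesgue (\<lambda>s. M * (indicat_real {a<..<t} s * ((t - s) powr (\<alpha> - 1) * (s - a) powr (k + 1 - 1))))"
      using Beta_kernel(1)[of \<alpha> "k + 1" a t] \<alpha> exponents t
      by (intro integrable_mult_right) (simp add: set_integrable_def)
    show "AE s in lebesgue. norm (J (y n) s) \<le> M * (indicat_real {a<..<t} s * ((t - s) powr (\<alpha> - 1) * (s - a) powr (k + 1 - 1)))" for n
    proof (rule AE_I2)
      fix s
      show "norm (J (y n) s) \<le> M * (indicat_real {a<..<t} s * ((t - s) powr (\<alpha> - 1) * (s - a) powr (k + 1 - 1)))"
      proof (cases "s \<in> {a<..<t}")
        case True
        then have "\<bar>g s (y n s)\<bar> \<le> M * (s - a) powr (k + 1 - 1)"
          using y[of n] t by (intro g_bound) (auto simp: admissible_def)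
        then show ?thesis using True mult_left_mono[of _ _ "(t - s) powr (\<alpha> - 1)"]
          by (fastforce simp: J_def abs_mult mult.left_commute)
      qed (simp add: J_def)
    qed
    show "AE s in lebesgue. (\<lambda>n. J (y n) s) \<longlonglongrightarrow> J Y s"
    proof (rule AE_I2)
      fix s
      show "(\<lambda>n. J (y n) s) \<longlonglongrightarrow> J Y s"
      proof (cases "s \<in> {a<..<t}")
        case True
        then have s: "s \<in> {a<..a + l}" using t by auto
        have "(\<lambda>n. g s (y n s)) \<longlonglongrightarrow> g s (Y s)"
        proof (rule continuous_on_tendsto_compose[OF g_continuous[OF s]])
          show "(\<lambda>n. y n s) \<longlonglongrightarrow> Y s" using Y_limit[OF s] by (simp add: y_def)
        qed (use y admissible_Y s in \<open>auto simp: admissible_def\<close>)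
        then show ?thesis unfolding J_def by (intro tendsto_intros)
      qed (simp add: J_def)
    qed
  qed (use Jm y admissible_Y in auto)
  then have "(\<lambda>n. x0 + (t - a) powr (1 - \<gamma>) / Gamma \<alpha> * (LINT s|lebesgue. J (y n) s))
      \<longlonglongrightarrow> x0 + (t - a) powr (1 - \<gamma>) / Gamma \<alpha> * (LINT s|lebesgue. J Y s)"
    by (intro tendsto_intros)
  then have "(\<lambda>n. P (y n) t) \<longlonglongrightarrow> P Y t"
    by (simp add: P_def J_def set_lebesgue_integral_def)
  moreover have "(\<lambda>n. P (y n) t) \<longlonglongrightarrow> Y t"
    using LIMSEQ_Suc[OF Y_limit[OF t]] by (simp add: y_def)
  ultimately show ?thesis by (rule LIMSEQ_unique)
qed

text \<open>The weight cancels the power built into g, and \<phi>_0 becomes the constant x0 from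
  which P is iterated.\<close>

lemma hilfer_picard_eq:
  assumes "t \<in> {a<..a + l}"
  shows "(t - a) powr (1 - \<gamma>) * hilfer_picard f \<alpha> \<gamma> a x0 n t = (P ^^ n) (\<lambda>_. x0) t"
  using assms
proof (induction n arbitrary: t)
  case 0
  then show ?case using powr_cancel'[of t x0] by (simp add: mult.commute)
next
  case (Suc n)
  have "(LINT s:{a<..<t}|lebesgue. (t - s) powr (\<alpha> - 1) / Gamma \<alpha> * f s (hilfer_picard f \<alpha> \<gamma> a x0 n s))
      = (LINT s:{a<..<t}|lebesgue. 1 / Gamma \<alpha> * ((t - s) powr (\<alpha> - 1) * g s ((P ^^ n) (\<lambda>_. x0) s)))"
  proof (intro set_lebesgue_integral_cong allI impI)
    fix s assume s: "s \<in> {a<..<t}"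
    then have "hilfer_picard f \<alpha> \<gamma> a x0 n s = (s - a) powr (\<gamma> - 1) * (P ^^ n) (\<lambda>_. x0) s"
      using Suc.prems powr_cancel[of s] by (subst Suc.IH[symmetric]) auto
    then show "(t - s) powr (\<alpha> - 1) / Gamma \<alpha> * f s (hilfer_picard f \<alpha> \<gamma> a x0 n s)
        = 1 / Gamma \<alpha> * ((t - s) powr (\<alpha> - 1) * g s ((P ^^ n) (\<lambda>_. x0) s))"
      by (simp add: g_def)
  qed simp
  also have "\<dots> = 1 / Gamma \<alpha> * (LINT s:{a<..<t}|lebesgue. (t - s) powr (\<alpha> - 1) * g s ((P ^^ n) (\<lambda>_. x0) s))"
    by (rule set_integral_mult_right)
  finally have "hilfer_picard f \<alpha> \<gamma> a x0 (Suc n) t = (t - a) powr (\<gamma> - 1) * x0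
      + 1 / Gamma \<alpha> * (LINT s:{a<..<t}|lebesgue. (t - s) powr (\<alpha> - 1) * g s ((P ^^ n) (\<lambda>_. x0) s))"
    by simp
  then have "(t - a) powr (1 - \<gamma>) * hilfer_picard f \<alpha> \<gamma> a x0 (Suc n) t = P ((P ^^ n) (\<lambda>_. x0)) t"
    using powr_cancel'[of t x0] Suc.prems by (simp only: distrib_left P_def) simp
  then show ?case by simp
qed

end

subsection \<open>Solutions as fixed points\<close>

text \<open>Test functions see only the open interval, whereas the integral equation is wanted at t
  = a + l too.\<close>

lemma eq_0_at_right_end:
  fixes w :: "real \<Rightarrow> real"
  assumes "a < c" "continuous_on {a<..c} w" "\<And>t. t \<in> {a<..<c} \<Longrightarrow> w t = 0"
  shows "w c = 0"
proof -
  have "(w \<longlongrightarrow> w c) (at c within {a<..c})"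
    using assms by (auto simp: continuous_on_def)
  moreover have "at c within {a<..c} = at_left c"
    using assms(1) by (intro at_within_nhd[of _ "{a<..}"]) auto
  ultimately have "(w \<longlongrightarrow> w c) (at_left c)" by simp
  moreover have "\<forall>\<^sub>F t in at_left c. w t = 0"
    using assms by (auto simp: eventually_at_left_field)
  then have "(w \<longlongrightarrow> 0) (at_left c)" by (rule tendsto_eventually)
  ultimately show ?thesis by (rule tendsto_unique[rotated]) simp
qed

context hilfer_ivp
begin

text \<open>With first exponent 1 the kernel is the constant 1 on the open interval, so the kernel
  bound becomes an integrability statement.\<close>

lemma integrable_g:
  assumes "admissible y"
  shows "set_integrable lebesgue {a<..<a + l} (\<lambda>s. g s (y s))"
proof -
  have "set_integrable lebesgue {a<..<a + l} (\<lambda>s. (a + l - s) powr (1 - 1) * g s (y s))"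
  proof (rule rl_kernel_bound(1)[where q = "k + 1"])
    show "set_borel_measurable lebesgue {a<..<a + l} (\<lambda>s. g s (y s))"
      by (rule set_borel_measurable_subset[OF g_measurable[OF assms]]) auto
    show "\<bar>g s (y s)\<bar> \<le> M * (s - a) powr (k + 1 - 1)" if "s \<in> {a<..<a + l}" for s
      using that assms by (intro g_bound) (auto simp: admissible_def)
  qed (use exponents pos in auto)
  then show ?thesis by (rule set_integrable_cong[THEN iffD1, rotated -1]) auto
qed

lemma integrable_solution:
  assumes "admissible y"
  shows "set_integrable lebesgue {a<..<a + l} (\<lambda>s. (s - a) powr (\<gamma> - 1) * y s)"
proof -
  have y: "\<bar>y s\<bar> \<le> \<bar>x0\<bar> + b" if "s \<in> {a<..<a + l}" for s
  proof -
    have "y s \<in> {x0 - b..x0 + b}" using assms that by (auto simp: admissible_def)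
    then show ?thesis by auto
  qed
  have "set_integrable lebesgue {a<..<a + l} (\<lambda>s. (a + l - s) powr (1 - 1) * ((s - a) powr (\<gamma> - 1) * y s))"
  proof (rule rl_kernel_bound(1)[where q = \<gamma> and M = "\<bar>x0\<bar> + b"])
    have "set_borel_measurable lebesgue {a<..a + l} y"
      using assms by (simp add: admissible_def set_borel_measurable_def borel_measurable_restrict_space_iff)
    then have "set_borel_measurable lebesgue {a<..<a + l} y"
      by (rule set_borel_measurable_subset) auto
    then have [measurable]: "(\<lambda>s. indicat_real {a<..<a + l} s * y s) \<in> borel_measurable lebesgue"
      by (simp add: set_borel_measurable_def)
    have "(\<lambda>s. (s - a) powr (\<gamma> - 1) * (indicat_real {a<..<a + l} s * y s)) \<in> borel_measurable lebesgue"
      by measurable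
    then show "set_borel_measurable lebesgue {a<..<a + l} (\<lambda>s. (s - a) powr (\<gamma> - 1) * y s)"
      by (simp add: set_borel_measurable_def mult.left_commute)
    show "\<bar>(s - a) powr (\<gamma> - 1) * y s\<bar> \<le> (\<bar>x0\<bar> + b) * (s - a) powr (\<gamma> - 1)" if "s \<in> {a<..<a + l}" for s
      using mult_left_mono[OF y[OF that], of "(s - a) powr (\<gamma> - 1)"] by (simp add: abs_mult mult.commute)
  qed (use exponents pos in auto)
  then show ?thesis by (rule set_integrable_cong[THEN iffD1, rotated -1]) auto
qed

lemma P_tendsto:
  assumes "admissible y"
  shows "(P y \<longlongrightarrow> x0) (at_right a)"
proof -
  have "((\<lambda>t. P y t - x0) \<longlongrightarrow> 0) (at_right a)"
  proof (rule Lim_null_comparison)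
    show "\<forall>\<^sub>F t in at_right a. norm (P y t - x0) \<le> M * Beta \<alpha> (k + 1) / Gamma \<alpha> * (t - a) powr \<sigma>"
      using kernel(2)[OF assms] pos
      by (auto simp: eventually_at_right_field intro!: exI[of _ "a + l"])
    have "((\<lambda>t. (t - a) powr \<sigma>) \<longlongrightarrow> 0) (at_right a)"
    proof (rule tendsto_zero_powrI[where b = \<sigma>])
      show "((\<lambda>t. t - a) \<longlongrightarrow> 0) (at_right a)"
        by (auto intro!: tendsto_eq_intros)
      show "\<forall>\<^sub>F t in at_right a. 0 \<le> t - a"
        by (auto simp: eventually_at_right_field intro: exI[of _ "a + 1"])
    qed (use exponents in auto)
    then show "((\<lambda>t. M * Beta \<alpha> (k + 1) / Gamma \<alpha> * (t - a) powr \<sigma>) \<longlongrightarrow> 0) (at_right a)"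
      by (rule tendsto_mult_right_zero)
  qed
  then show ?thesis by (rule LIM_zero_cancel)
qed

lemma P_eq_rl_integral:
  assumes "t \<in> {a<..a + l}"
  shows "(t - a) powr (\<gamma> - 1) * P y t = x0 * (t - a) powr (\<gamma> - 1) + rl_integral a \<alpha> (\<lambda>s. g s (y s)) t"
  using powr_cancel[of t "1 / Gamma \<alpha> * (LINT s:{a<..<t}|lebesgue. (t - s) powr (\<alpha> - 1) * g s (y s))"] assms \<alpha>
  by (simp add: P_def rl_integral_def distrib_left)

lemma fixed_point_imp_solution:
  assumes G: "\<And>t v. t \<in> {a<..a + l} \<Longrightarrow> (t, v) \<in> G \<longleftrightarrow> (t - a) powr (1 - \<gamma>) * v \<in> {x0 - b..x0 + b}"
    and y: "admissible y" "\<And>t. t \<in> {a<..a + l} \<Longrightarrow> P y t = y t"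
  shows "hilfer_ivp_solution G f \<alpha> \<beta> a x0 l (\<lambda>t. (t - a) powr (\<gamma> - 1) * y t)"
proof -
  let ?x = "\<lambda>t. (t - a) powr (\<gamma> - 1) * y t"
  have lim: "((\<lambda>t. (t - a) powr (1 - \<gamma>) * ?x t) \<longlongrightarrow> x0) (at_right a)"
  proof -
    have "\<forall>\<^sub>F t in at_right a. P y t = (t - a) powr (1 - \<gamma>) * ?x t"
      using y(2) powr_cancel' pos by (auto simp: eventually_at_right_field intro!: exI[of _ "a + l"])
    then show ?thesis using P_tendsto[OF y(1)] by (simp cong: tendsto_cong)
  qed
  \<comment> \<open>Since y is only known to be measurable, continuity is proved for
    \<open>P y\<close>, which agrees with y on the interval.\<close>
  have "continuous_on {a<..a + l} (\<lambda>t. (t - a) powr (\<gamma> - 1) * P y t)"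
    by (intro continuous_intros continuous_P y) auto
  then have "continuous_on {a<..a + l} ?x"
    by (rule continuous_on_cong[THEN iffD1, rotated -1]) (use y in auto)
  moreover have "(t, ?x t) \<in> G" if t: "t \<in> {a<..a + l}" for t
  proof -
    have eq: "(t - a) powr (1 - \<gamma>) * ?x t = y t" by (rule powr_cancel') (use t in auto)
    have "y t \<in> {x0 - b..x0 + b}" using y(1) t by (simp add: admissible_def)
    then show ?thesis unfolding G[OF t] eq .
  qed
  moreover have "has_hilfer_deriv a (a + l) \<alpha> \<beta> ?x (\<lambda>s. g s (y s))"
  proof (rule has_hilfer_deriv_of_integral_equation)
    show "(rl_integral a ((1 - \<beta>) * (1 - \<alpha>)) ?x \<longlongrightarrow> x0 * Gamma (\<alpha> + \<beta> * (1 - \<alpha>))) (at_right a)"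
      using rl_integral_limit[OF exponents(1,2) _ integrable_solution[OF y(1)] lim] pos
      by (simp add: exponents(5) \<gamma>_def[symmetric])
    show "?x t = x0 * (t - a) powr (\<alpha> + \<beta> * (1 - \<alpha>) - 1) + rl_integral a \<alpha> (\<lambda>s. g s (y s)) t"
      if "t \<in> {a<..<a + l}" for t
      using P_eq_rl_integral[of t y] y(2)[of t] that by (simp add: \<gamma>_def[symmetric])
  qed (use \<alpha> \<beta> pos integrable_solution integrable_g y in auto)
  moreover have "g t (y t) = f t (?x t)" for t by (simp add: g_def)
  ultimately show ?thesis
    using lim unfolding hilfer_ivp_solution_def \<gamma>_def[symmetric] by auto
qed

text \<open>The derivative u is determined only almost everywhere, but its fractional integral is
  determined at every point. The residual w of the integral equation is thus a continuous function
  that vanishes against all test functions.\<close>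

lemma solution_imp_fixed_point:
  assumes G: "\<And>t v. t \<in> {a<..a + l} \<Longrightarrow> (t, v) \<in> G \<longleftrightarrow> (t - a) powr (1 - \<gamma>) * v \<in> {x0 - b..x0 + b}"
    and x: "hilfer_ivp_solution G f \<alpha> \<beta> a x0 l x"
  defines "y \<equiv> \<lambda>t. (t - a) powr (1 - \<gamma>) * x t"
  shows "admissible y" "\<And>t. t \<in> {a<..a + l} \<Longrightarrow> P y t = y t"
proof -
  have cont: "continuous_on {a<..a + l} x" and xG: "\<And>t. t \<in> {a<..a + l} \<Longrightarrow> (t, x t) \<in> G"
    and lim: "((\<lambda>t. (t - a) powr (1 - \<gamma>) * x t) \<longlongrightarrow> x0) (at_right a)"
    using x by (auto simp: hilfer_ivp_solution_def \<gamma>_def)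
  obtain u where u: "has_hilfer_deriv a (a + l) \<alpha> \<beta> x u"
    and ae: "AE t in lebesgue. t \<in> {a<..a + l} \<longrightarrow> u t = f t (x t)"
    using x by (auto simp: hilfer_ivp_solution_def)
  show y: "admissible y"
    unfolding admissible_def
  proof (intro conjI continuous_measurable ballI)
    show "continuous_on {a<..a + l} y" unfolding y_def by (intro continuous_intros cont) auto
    show "y t \<in> {x0 - b..x0 + b}" if "t \<in> {a<..a + l}" for t
      using xG[OF that] G[OF that] by (simp add: y_def)
  qed
  define F where "F = (\<lambda>s. g s (y s))"
  have F: "f s (x s) = F s" if "s > a" for s
  proof -
    have "(s - a) powr (\<gamma> - 1) * y s = x s" unfolding y_def by (rule powr_cancel[OF that])
    then show ?thesis by (simp add: F_def g_def)
  qed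
  have ui: "set_integrable lebesgue {a<..<a + l} u" and xi: "set_integrable lebesgue {a<..<a + l} x"
    using u by (auto simp: has_hilfer_deriv_def)
  \<comment> \<open>Null sets do not affect the integral, so the almost everywhere equation yields
    equality at every t.\<close>
  have rl: "rl_integral a \<alpha> u t = rl_integral a \<alpha> F t" if t: "t \<in> {a<..a + l}" for t
  proof -
    have "(LINT s:{a<..<t}|lebesgue. (t - s) powr (\<alpha> - 1) * u s) = (LINT s:{a<..<t}|lebesgue. (t - s) powr (\<alpha> - 1) * F s)"
      unfolding set_lebesgue_integral_def
    proof (rule integral_cong_AE)
      have "set_integrable lebesgue {a<..<t} u" by (rule set_integrable_subset[OF ui]) (use t in auto)
      then have [measurable]: "(\<lambda>s. indicat_real {a<..<t} s * u s) \<in> borel_measurable lebesgue"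
        by (auto simp: set_integrable_def)
      have "(\<lambda>s. (t - s) powr (\<alpha> - 1) * (indicat_real {a<..<t} s * u s)) \<in> borel_measurable lebesgue"
        by measurable
      then show "(\<lambda>s. indicat_real {a<..<t} s *\<^sub>R ((t - s) powr (\<alpha> - 1) * u s)) \<in> borel_measurable lebesgue"
        by (simp add: mult.left_commute)
      show "(\<lambda>s. indicat_real {a<..<t} s *\<^sub>R ((t - s) powr (\<alpha> - 1) * F s)) \<in> borel_measurable lebesgue"
        using kernel(1)[OF y t] by (auto simp: F_def set_integrable_def)
      show "AE s in lebesgue. indicat_real {a<..<t} s *\<^sub>R ((t - s) powr (\<alpha> - 1) * u s)
          = indicat_real {a<..<t} s *\<^sub>R ((t - s) powr (\<alpha> - 1) * F s)"
        using ae by eventually_elim (use F t in \<open>auto simp: indicator_def\<close>)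
    qed
    then show ?thesis using \<alpha> by (simp add: rl_integral_def)
  qed
  \<comment> \<open>F replaces u because its power bound makes the fractional integral continuous,
    while u is merely integrable.\<close>
  define w where "w = (\<lambda>t. x t - x0 * (t - a) powr (\<gamma> - 1) - rl_integral a \<alpha> F t)"
  have w: "continuous_on {a<..a + l} w"
    unfolding w_def rl_integral_def F_def using \<alpha> less_imp_neq[OF Gamma_\<alpha>]
    by (auto intro!: continuous_intros cont continuous_rl_g[OF y])
  have c: "(rl_integral a ((1 - \<beta>) * (1 - \<alpha>)) x \<longlongrightarrow> x0 * Gamma (\<alpha> + \<beta> * (1 - \<alpha>))) (at_right a)"
    using rl_integral_limit[OF exponents(1,2) _ xi lim] pos by (simp add: exponents(5) \<gamma>_def[symmetric])
  note tested = integral_equation_tested[OF \<alpha> \<beta> _ u c, folded \<gamma>_def]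
  have eq: "(x t - x0 * (t - a) powr (\<gamma> - 1) - rl_integral a \<alpha> u t) * \<psi> t = w t * \<psi> t" if "t \<in> {a<..<a + l}" for t \<psi>
    using rl[of t] that by (simp add: w_def)
  have w0: "w t = 0" if "t \<in> {a<..<a + l}" for t
  proof (rule continuous_eq_0_of_tested[OF _ _ _ that])
    show "continuous_on {a<..<a + l} w" by (rule continuous_on_subset[OF w]) auto
    fix \<psi> assume \<psi>: "test_function (a + l) \<psi>"
    show "set_integrable lebesgue {a<..<a + l} (\<lambda>t. w t * \<psi> t)"
    proof (rule set_integrable_cong[THEN iffD1, OF refl refl _ tested(1)[OF _ \<psi>]])
      show "a < a + l" using pos by simp
    qed (rule eq)
    have "(LINT t:{a<..<a + l}|lebesgue. w t * \<psi> t)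
        = (LINT t:{a<..<a + l}|lebesgue. (x t - x0 * (t - a) powr (\<gamma> - 1) - rl_integral a \<alpha> u t) * \<psi> t)"
      by (intro set_lebesgue_integral_cong allI impI eq[symmetric]) auto
    then show "(LINT t:{a<..<a + l}|lebesgue. w t * \<psi> t) = 0"
      using tested(2)[OF _ \<psi>] pos by simp
  qed
  fix t assume t: "t \<in> {a<..a + l}"
  have "w t = 0"
    using w0[of t] eq_0_at_right_end[OF _ w w0] t pos by (cases "t = a + l") auto
  then have "x t = (t - a) powr (\<gamma> - 1) * P y t"
    using P_eq_rl_integral[OF t, of y] by (simp add: w_def F_def)
  then show "P y t = y t"
    using powr_cancel'[of t "P y t"] t by (simp add: y_def)
qed

end

theorem theorem3:
  fixes \<alpha> \<beta> \<gamma> \<mu> a x0 h b k M l :: real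
    and E :: "real set" and G :: "(real \<times> real) set"
    and f :: "real \<Rightarrow> real \<Rightarrow> real"
  assumes "0 < \<alpha>" "\<alpha> < 1" "0 \<le> \<beta>" "\<beta> \<le> 1"
    and \<gamma>: "\<gamma> = \<alpha> + \<beta> * (1 - \<alpha>)"
    and "h > 0" "b > 0"
    and E: "E = {y. \<bar>y - x0\<bar> \<le> b}"
    and G: "G = {(t, x). t \<in> {a<..a + h} \<and> (t - a) powr (1 - \<gamma>) * x \<in> E}"
    and "k > \<beta> * (1 - \<alpha>) - 1" "M \<ge> 0"
    and \<mu>: "\<mu> = 1 - \<beta> * (1 - \<alpha>)"
    and l: "l = (if M = 0 then h
                 else min h ((b / M * (Gamma \<alpha> / Beta \<alpha> (k + 1))) powr (1 / (\<mu> + k))))"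
    and continuous: "\<And>t. t \<in> {a<..a + h} \<Longrightarrow>
          continuous_on E (\<lambda>y. f t ((t - a) powr (\<gamma> - 1) * y))"
    and measurable: "\<And>y. y \<in> E \<Longrightarrow>
          (\<lambda>t. f t ((t - a) powr (\<gamma> - 1) * y)) \<in> borel_measurable (lebesgue_on {a<..a + h})"
    and bound: "\<And>t y. t \<in> {a<..a + h} \<Longrightarrow> y \<in> E \<Longrightarrow>
          \<bar>f t ((t - a) powr (\<gamma> - 1) * y)\<bar> \<le> M * (t - a) powr k"
    and lipschitz: "\<exists>A>0. \<forall>t\<in>{a<..a + l}. \<forall>y1\<in>E. \<forall>y2\<in>E.
          \<bar>f t ((t - a) powr (\<gamma> - 1) * y1) - f t ((t - a) powr (\<gamma> - 1) * y2)\<bar>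
            \<le> A * (t - a) powr k * \<bar>y1 - y2\<bar>"
  shows "\<exists>\<phi>. hilfer_ivp_solution G f \<alpha> \<beta> a x0 l \<phi> \<and>
           (\<forall>x. hilfer_ivp_solution G f \<alpha> \<beta> a x0 l x \<longrightarrow> (\<forall>t\<in>{a<..a + l}. x t = \<phi> t)) \<and>
           (\<forall>t\<in>{a<..a + l}.
              convergent (\<lambda>n. (t - a) powr (1 - \<gamma>) * hilfer_picard f \<alpha> \<gamma> a x0 n t) \<and>
              \<phi> t = (t - a) powr (\<gamma> - 1) *
                lim (\<lambda>n. (t - a) powr (1 - \<gamma>) * hilfer_picard f \<alpha> \<gamma> a x0 n t))"
proof -
  have \<beta>\<alpha>: "\<beta> * (1 - \<alpha>) \<ge> 0" using assms by simp
  have \<sigma>: "\<mu> + k > 0" using assms by simp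
  have "k + 1 > 0" using \<beta>\<alpha> \<open>k > \<beta> * (1 - \<alpha>) - 1\<close> by linarith
  then have pos: "Gamma \<alpha> > 0" "Beta \<alpha> (k + 1) > 0"
    using \<open>0 < \<alpha>\<close> by (auto intro!: Beta_real_pos)
  have ne: "Gamma \<alpha> \<noteq> 0" "Beta \<alpha> (k + 1) \<noteq> 0" using pos by linarith+
  have l0: "l > 0" and lh: "l \<le> h" using \<open>h > 0\<close> \<open>b > 0\<close> ne by (auto simp: l)
  have E': "E = {x0 - b..x0 + b}" by (auto simp: E abs_le_iff)
  have sub: "t \<in> {a<..a + h}" if "t \<in> {a<..a + l}" for t using that lh by auto
  \<comment> \<open>For M > 0, l is at most the length at which the left-hand side equals b; for M =
    0 the left-hand side is 0.\<close>
  have small: "M * Beta \<alpha> (k + 1) / Gamma \<alpha> * l powr (\<mu> + k) \<le> b"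
  proof (cases "M = 0")
    case False
    let ?q = "b / M * (Gamma \<alpha> / Beta \<alpha> (k + 1))"
    have "l powr (\<mu> + k) \<le> (?q powr (1 / (\<mu> + k))) powr (\<mu> + k)"
      using False l l0 \<sigma> by (intro powr_mono2) auto
    also have "\<dots> = ?q" using \<sigma> pos assms False by (simp add: powr_powr)
    finally have "M * Beta \<alpha> (k + 1) / Gamma \<alpha> * l powr (\<mu> + k) \<le> M * Beta \<alpha> (k + 1) / Gamma \<alpha> * ?q"
      using pos assms by (intro mult_left_mono) auto
    also have "\<dots> = b" using ne False by simp
    finally show ?thesis .
  qed (use assms in simp)
  obtain A where A: "A > 0" "\<And>t y1 y2. t \<in> {a<..a + l} \<Longrightarrow> y1 \<in> E \<Longrightarrow> y2 \<in> E \<Longrightarrow>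
      \<bar>f t ((t - a) powr (\<gamma> - 1) * y1) - f t ((t - a) powr (\<gamma> - 1) * y2)\<bar> \<le> A * (t - a) powr k * \<bar>y1 - y2\<bar>"
    using lipschitz by blast
  interpret ivp: hilfer_ivp \<alpha> \<beta> a x0 b k M A l f
  proof
    show "(\<lambda>s. f s ((s - a) powr (\<alpha> + \<beta> * (1 - \<alpha>) - 1) * v)) \<in> borel_measurable (lebesgue_on {a<..a + l})"
      if "v \<in> {x0 - b..x0 + b}" for v
    proof -
      have "v \<in> E" using that by (simp only: E')
      then show ?thesis
        using measurable_restrict_mono[OF measurable[unfolded \<gamma>], of v "{a<..a + l}"] sub by blast
    qed
    show "\<bar>f s ((s - a) powr (\<alpha> + \<beta> * (1 - \<alpha>) - 1) * v)\<bar> \<le> M * (s - a) powr k"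
      if "s \<in> {a<..a + l}" "v \<in> {x0 - b..x0 + b}" for s v
      using bound[OF sub] that by (simp only: E' \<gamma>)
    show "\<bar>f s ((s - a) powr (\<alpha> + \<beta> * (1 - \<alpha>) - 1) * v) - f s ((s - a) powr (\<alpha> + \<beta> * (1 - \<alpha>) - 1) * w)\<bar>
        \<le> A * (s - a) powr k * \<bar>v - w\<bar>"
      if "s \<in> {a<..a + l}" "v \<in> {x0 - b..x0 + b}" "w \<in> {x0 - b..x0 + b}" for s v w
      using A(2) that by (simp only: E' \<gamma>)
    show "M * Beta \<alpha> (k + 1) / Gamma \<alpha> * l powr (1 - \<beta> * (1 - \<alpha>) + k) \<le> b"
      using small by (simp only: \<mu>)
  qed (fact assms l0 A(1))+
  have \<gamma>': "ivp.\<gamma> = \<gamma>" by (simp add: ivp.\<gamma>_def \<gamma>)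
  \<comment> \<open>G refers to the longer interval of length h; since l \<le> h, its time condition
    holds throughout \<open>{a<..a + l}\<close>.\<close>
  have G': "(t, v) \<in> G \<longleftrightarrow> (t - a) powr (1 - ivp.\<gamma>) * v \<in> {x0 - b..x0 + b}" if "t \<in> {a<..a + l}" for t v
    using sub[OF that] by (simp add: G E' \<gamma>')
  \<comment> \<open>Every rescaled solution is an admissible fixed point and so equals Y; with Y
    itself giving a solution, this settles uniqueness and the limit formula together.\<close>
  have "x t = (t - a) powr (\<gamma> - 1) * ivp.Y t"
    if x: "hilfer_ivp_solution G f \<alpha> \<beta> a x0 l x" and t: "t \<in> {a<..a + l}" for x t
  proof -
    have "(t - a) powr (1 - ivp.\<gamma>) * x t = ivp.Y t"
      by (rule ivp.fixed_point_unique[OF ivp.solution_imp_fixed_point(1)[OF G' x] ivp.admissible_Y t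
            ivp.solution_imp_fixed_point(2)[OF G' x] ivp.P_Y])
    then show ?thesis using ivp.powr_cancel[of t "x t"] t by (simp add: \<gamma>')
  qed
  moreover have "hilfer_ivp_solution G f \<alpha> \<beta> a x0 l (\<lambda>t. (t - a) powr (\<gamma> - 1) * ivp.Y t)"
    using ivp.fixed_point_imp_solution[OF G' ivp.admissible_Y ivp.P_Y] by (simp add: \<gamma>')
  moreover have "convergent (\<lambda>n. (t - a) powr (1 - \<gamma>) * hilfer_picard f \<alpha> \<gamma> a x0 n t)"
    "ivp.Y t = lim (\<lambda>n. (t - a) powr (1 - \<gamma>) * hilfer_picard f \<alpha> \<gamma> a x0 n t)" if "t \<in> {a<..a + l}" for t
    using ivp.convergent_iterates[OF that] ivp.hilfer_picard_eq[OF that] by (simp_all add: \<gamma>' ivp.Y_def)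
  ultimately show ?thesis
    by (intro exI[of _ "\<lambda>t. (t - a) powr (\<gamma> - 1) * ivp.Y t"] conjI allI ballI impI) (blast, blast, blast, metis)
qed

end
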